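(* For each $\ell$ with $1\le \ell\le r(n-1)+1$, the straightening relations on $X(\tau_\ell)$, namely the linear relations $$p_I=\sum_{S}a_{S}\,p_S,\qquad a_{S}\in K,\ \text{the sum over admissible } r\text{-tuples } S,$$ for non-admissible $r$-tuples $I$ with $p_I|_{X(w_s)}\ne 0$ (for every such $I$ a relation of this form holds on $X(w_s)$, and hence on $X(\tau_\ell)\subset X(w_s)$), give a set of generators for the degree-one part of the ideal of $X(\tau_\ell)$ considered as a closed subvariety of $\mathrm{Gr}(sn,V_s)$.
   Context: $K$ is an algebraically closed field of arbitrary characteristic, $A=K[[t]]$, $F=K((t))$. Fix positive integers $n,s$ and put $r=sn$. Let $e_1,\dots,e_n$ be the standard basis of $F^n$ and put $e_{cn+i}:=t^ce_i$ for $1\le i\le n$, $c\in\mathbb{Z}$. Let $L_1=A^n$ and $V_s=L_1/t^{r}L_1$, a $K$-space with basis (the images of) $e_1,\dots,e_{rn}$, on which multiplication by $t$ acts by $e_k\mapsto e_{k+n}$ (zero if $k+n>rn$). Schubert varieties: for an $r$-tuple $I=(i_1<\dots<i_r)$ in $\{1,\dots,rn\}$ such that $E_I=\mathrm{Span}_K(e_i: i\in I)\subset V_s$ is $t$-stable, let $X^\circ(I)\subset \mathrm{Gr}(r,V_s)$ be the orbit of $E_I$ under $\mathcal{B}=\{g\in GL_n(A): \mathrm{ord}(g_{ij})>0\text{ for } i<j\}$ (acting through $L_1/t^rL_1$), and let $X(I)$ be its Zariski closure with reduced structure. For $w_s=(1,n+1,2n+1,\dots,(r-1)n+1)$, $X(w_s)$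 is the variety of all $r$-dimensional $t$-stable subspaces of $V_s$. Plücker coordinates: $p_I$ is the $r\times r$ minor with row set $I$ of the $rn\times r$ matrix whose columns are a basis of a subspace; $\mathrm{Gr}(sn,V_s)=\mathrm{Gr}(r,V_s)$ is embedded in $\mathbb{P}(\wedge^rV_s)$ by the $p_I$. Chain: for $1\le i\le r$, $1\le j\le n$ let $$\varphi_{ij}=\big((i-1)n+1+j-i,\ in+1+j-i,\ \dots,\ (r-1)n+1+j-i,\ rn+2-i,\ rn+3-i,\dots,\ rn\big)$$ (the first $r+1-i$ entries have successive differences $n$, the remaining $i-1$ entries are consecutive integers), and put $\tau_{(i-1)(n-1)+j}:=\varphi_{ij}$; this is consistent since $\varphi_{in}=\varphi_{i+1,1}$. This gives $w_s=\tau_1>\tau_2>\dots>\tau_{r(n-1)+1}=\mathrm{id}$. Admissibility: an $r$-tuple $S=(s_1<\dots<s_r)$ in $\{1,\dots,rn\}$ stands for the infinite sequence $(s_1,\dots,s_r,rn+1,rn+2,\dots)$; it is admissible if $s_{j+1}-s_j\le n$ for all $j\ge1$ (with $s_{r+1}=rn+1$).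
   Formalization: The generating set consists of the straightening relations together with the relations p_J = 0 for the Plücker coordinates vanishing identically on X(τ_ℓ); without these the claim fails, e.g. p_12 on X(w_s) for n=2, s=1. *)

theory Defs
  imports
    "HOL-Library.Poly_Mapping"
    "HOL-Library.Function_Algebras"
    "HOL-Computational_Algebra.Polynomial"
    "HOL-Computational_Algebra.Formal_Power_Series"
    "Jordan_Normal_Form.Determinant"
begin

subsection \<open>The space \<open>V_s = L_1 / t^r L_1\<close>\<close>

text \<open>
  Throughout \<open>r = s n\<close>.  A vector of \<open>V_s\<close> is given by its coordinates with respect to the images
  of \<open>e_1, ..., e_{rn}\<close>: a function \<open>nat \<Rightarrow> 'a\<close> that is zero outside \<open>{1..r n}\<close>.
\<close>

definition fscale :: "'a::field \<Rightarrow> (nat \<Rightarrow> 'a) \<Rightarrow> nat \<Rightarrow> 'a" where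
  "fscale c v = (\<lambda>k. c * v k)"

global_interpretation fvec: vector_space fscale
  by unfold_locales (auto simp: fscale_def fun_eq_iff algebra_simps)

definition Vs :: "nat \<Rightarrow> nat \<Rightarrow> (nat \<Rightarrow> 'a::field) set" where
  "Vs n r = {v. \<forall>k. k \<notin> {1..r * n} \<longrightarrow> v k = 0}"

definition ebasis :: "nat \<Rightarrow> nat \<Rightarrow> 'a::field" where
  "ebasis i = (\<lambda>k. if k = i then 1 else 0)"

text \<open>
  The quotient map \<open>L_1 \<rightarrow> V_s\<close>.  Vectors of the Jordan_Normal_Form library are indexed from 0,
  so \<open>e_{cn+i} = t^c e_i\<close> with \<open>1 \<le> i \<le> n\<close> corresponds to the \<open>c\<close>-th coefficient of entry \<open>i - 1\<close>.
\<close>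

definition quot :: "nat \<Rightarrow> nat \<Rightarrow> 'a::field fps vec \<Rightarrow> nat \<Rightarrow> 'a" where
  "quot n r f = (\<lambda>k. if k \<in> {1..r * n}
     then fps_nth (f $ ((k - 1) mod n)) ((k - 1) div n) else 0)"

subsection \<open>The Grassmannian and Pluecker coordinates\<close>

definition Gr :: "nat \<Rightarrow> nat \<Rightarrow> (nat \<Rightarrow> 'a::field) set set" where
  "Gr n r = {W. W \<subseteq> Vs n r \<and> fvec.subspace W \<and> fvec.dim W = r}"

definition basis_of :: "nat \<Rightarrow> (nat \<Rightarrow> nat \<Rightarrow> 'a::field) \<Rightarrow> (nat \<Rightarrow> 'a) set \<Rightarrow> bool" where
  "basis_of r b W \<longleftrightarrow> inj_on b {..<r} \<and> fvec.independent (b ` {..<r}) \<and> fvec.span (b ` {..<r}) = W"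

definition tuples :: "nat \<Rightarrow> nat \<Rightarrow> nat list set" where
  "tuples n r = {I. length I = r \<and> sorted_wrt (<) I \<and> set I \<subseteq> {1..r * n}}"

definition plucker :: "nat \<Rightarrow> (nat \<Rightarrow> nat \<Rightarrow> 'a::field) \<Rightarrow> nat list \<Rightarrow> 'a" where
  "plucker r b I = det (mat r r (\<lambda>(k, l). b l (I ! k)))"

text \<open>
  Polynomials in the indeterminates \<open>p_I\<close>: a monomial is a finitely supported exponent function on
  tuples, a polynomial a finitely supported coefficient function on monomials.
\<close>

type_synonym 'a ppoly = "(nat list \<Rightarrow>\<^sub>0 nat) \<Rightarrow>\<^sub>0 'a"

definition pconst :: "'a::field \<Rightarrow> 'a ppoly" where
  "pconst c = Poly_Mapping.single 0 c"

definition pvar :: "nat list \<Rightarrow> 'a::field ppoly" where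
  "pvar I = Poly_Mapping.single (Poly_Mapping.single I 1) 1"

global_interpretation ppoly: vector_space "\<lambda>c (P :: 'a::field ppoly). pconst c * P"
  by unfold_locales
    (auto simp: pconst_def algebra_simps single_add mult_single simp flip: mult.assoc)

definition peval :: "(nat list \<Rightarrow> 'a::field) \<Rightarrow> 'a ppoly \<Rightarrow> 'a" where
  "peval x P = (\<Sum>m\<in>Poly_Mapping.keys P. Poly_Mapping.lookup P m *
     (\<Prod>I\<in>Poly_Mapping.keys m. x I ^ Poly_Mapping.lookup m I))"

definition hom_polys :: "nat \<Rightarrow> nat \<Rightarrow> nat \<Rightarrow> 'a::field ppoly set" where
  "hom_polys n r d = {P. \<forall>m\<in>Poly_Mapping.keys P. Poly_Mapping.keys m \<subseteq> tuples n r \<and>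
     (\<Sum>I\<in>Poly_Mapping.keys m. Poly_Mapping.lookup m I) = d}"

text \<open>
  For a subspace \<open>W\<close> in \<open>Gr n r\<close> the vectors \<open>plucker r b\<close>, \<open>b\<close> ranging over the bases of \<open>W\<close>, are
  the homogeneous coordinate vectors of one point of projective space.
\<close>

definition vanishes_on :: "nat \<Rightarrow> (nat \<Rightarrow> 'a::field) set set \<Rightarrow> 'a ppoly \<Rightarrow> bool" where
  "vanishes_on r X P \<longleftrightarrow> (\<forall>W\<in>X. \<forall>b. basis_of r b W \<longrightarrow> peval (plucker r b) P = 0)"

definition ideal_part :: "nat \<Rightarrow> nat \<Rightarrow> nat \<Rightarrow> (nat \<Rightarrow> 'a::field) set set \<Rightarrow> 'a ppoly set" where
  "ideal_part n r d X = {P \<in> hom_polys n r d. vanishes_on r X P}"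

definition zariski_closure ::
    "nat \<Rightarrow> nat \<Rightarrow> (nat \<Rightarrow> 'a::field) set set \<Rightarrow> (nat \<Rightarrow> 'a) set set" where
  "zariski_closure n r X = {W \<in> Gr n r. \<forall>d. \<forall>P\<in>ideal_part n r d X. vanishes_on r {W} P}"

subsection \<open>Schubert varieties\<close>

text \<open>
  The condition \<open>ord (g_ij) > 0\<close> is expressed by the vanishing of the constant coefficient, since
  \<open>ord 0 = \<infinity>\<close>, whereas \<^term>\<open>subdegree (0 :: 'a::zero fps) = 0\<close>.
\<close>

definition iwahori :: "nat \<Rightarrow> 'a::field fps mat set" where
  "iwahori n = {g \<in> carrier_mat n n. invertible_mat g \<and>
     (\<forall>i j. i < j \<and> j < n \<longrightarrow> fps_nth (g $$ (i, j)) 0 = 0)}"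

text \<open>The action through \<open>L_1 / t^r L_1\<close>: lift to \<open>L_1\<close>, apply \<open>g\<close>, and project.\<close>

definition act :: "nat \<Rightarrow> nat \<Rightarrow> 'a::field fps mat \<Rightarrow> (nat \<Rightarrow> 'a) set \<Rightarrow> (nat \<Rightarrow> 'a) set" where
  "act n r g W = {quot n r (g *\<^sub>v f) | f. f \<in> carrier_vec n \<and> quot n r f \<in> W}"

definition Espan :: "nat list \<Rightarrow> (nat \<Rightarrow> 'a::field) set" where
  "Espan I = fvec.span (ebasis ` set I)"

definition schubert_cell :: "nat \<Rightarrow> nat \<Rightarrow> nat list \<Rightarrow> (nat \<Rightarrow> 'a::field) set set" where
  "schubert_cell n r I = (\<lambda>g. act n r g (Espan I)) ` iwahori n"

text \<open>
  The base field being algebraically closed, the closure with its reduced structure is determined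
  by its set of points.
\<close>

definition schubert_var :: "nat \<Rightarrow> nat \<Rightarrow> nat list \<Rightarrow> (nat \<Rightarrow> 'a::alg_closed_field) set set" where
  "schubert_var n r I = zariski_closure n r (schubert_cell n r I)"

subsection \<open>The chain of tuples and admissibility\<close>

definition ws :: "nat \<Rightarrow> nat \<Rightarrow> nat list" where
  "ws n r = map (\<lambda>k. k * n + 1) [0..<r]"

definition phi :: "nat \<Rightarrow> nat \<Rightarrow> nat \<Rightarrow> nat \<Rightarrow> nat list" where
  "phi n r i j = map (\<lambda>k. if k < r + 1 - i then (i - 1 + k) * n + 1 + j - i
                          else r * n + 1 + k - r) [0..<r]"

text \<open>
  Division with remainder recovers \<open>(i, j)\<close> from the index \<open>(i - 1) (n - 1) + j\<close>; see the lemma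
  \<open>tau_phi\<close> below.  For \<open>n = 1\<close> the only index is \<open>1\<close>, and \<open>x div 0 = 0\<close>, \<open>0 mod 0 = 0\<close>.
\<close>

definition tau :: "nat \<Rightarrow> nat \<Rightarrow> nat \<Rightarrow> nat list" where
  "tau n r l = phi n r ((l - 1) div (n - 1) + 1) ((l - 1) mod (n - 1) + 1)"

lemma phi_step:
  assumes "n > 0" "1 \<le> i" "i \<le> r"
  shows "phi n r i n = phi n r (Suc i) 1"
proof -
  have shift: "(i - 1 + k) * n + 1 + n - i = (i + k) * n + 1 - i" for k
    using assms by (cases i) (auto simp: algebra_simps)
  have "(if k < r + 1 - i then (i - 1 + k) * n + 1 + n - i else r * n + 1 + k - r) =
    (if k < r + 1 - Suc i then (Suc i - 1 + k) * n + 1 + 1 - Suc i else r * n + 1 + k - r)" for k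
  proof -
    consider "k < r - i" | "k = r - i" | "k > r - i" by linarith
    then show ?thesis
    proof cases
      case 1
      then show ?thesis using assms shift[of k] by simp
    next
      case 2
      then have "(i + k) * n + 1 - i = r * n + 1 + k - r" using assms by simp
      then show ?thesis using 2 assms shift[of k] by simp
    next
      case 3
      then show ?thesis using assms by simp
    qed
  qed
  then show ?thesis by (simp add: phi_def)
qed

lemma tau_phi:
  assumes "n > 0" "1 \<le> i" "i \<le> r" "1 \<le> j" "j \<le> n"
  shows "tau n r ((i - 1) * (n - 1) + j) = phi n r i j"
proof (cases "n = 1")
  case True
  have "(i - 1 + k) + 1 + 1 - i = k + 1" for k using assms by simp
  moreover have "r + 1 + k - r = k + 1" for k by simp
  ultimately show ?thesis
    using True assms by (auto simp: tau_def phi_def)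
next
  case n: False
  show ?thesis
  proof (cases "j = n")
    case True
    have e: "(i - 1) * (n - 1) + n - 1 = i * (n - 1)"
      using assms n by (cases i) (auto simp: algebra_simps)
    show ?thesis
      unfolding tau_def True e using n assms phi_step[of n i r] by simp
  next
    case False
    have e: "(i - 1) * (n - 1) + j - 1 = (j - 1) + (i - 1) * (n - 1)"
      using assms by simp
    have "(j - 1) < n - 1" using False assms by simp
    then have "((j - 1) + (i - 1) * (n - 1)) div (n - 1) = i - 1"
      "((j - 1) + (i - 1) * (n - 1)) mod (n - 1) = j - 1"
      by auto
    then show ?thesis using assms unfolding tau_def e by simp
  qed
qed

lemma tau_1: "tau n r 1 = ws n r"
  by (auto simp: tau_def phi_def ws_def)

lemma tau_last:
  assumes "n > 0" "r > 0"
  shows "tau n r (r * (n - 1) + 1) = map (\<lambda>k. r * n + 1 + k - r) [0..<r]"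
proof (cases "n = 1")
  case True
  then show ?thesis by (auto simp: tau_def phi_def)
next
  case False
  then show ?thesis using assms by (simp add: tau_def phi_def)
qed

definition seq_ext :: "nat \<Rightarrow> nat \<Rightarrow> nat list \<Rightarrow> nat \<Rightarrow> nat" where
  "seq_ext n r S k = (if k < r then S ! k else r * n + 1 + (k - r))"

definition admissible :: "nat \<Rightarrow> nat \<Rightarrow> nat list \<Rightarrow> bool" where
  "admissible n r S \<longleftrightarrow> (\<forall>k. seq_ext n r S (Suc k) \<le> seq_ext n r S k + n)"

subsection \<open>Straightening relations\<close>

definition straightening_indices :: "'a::alg_closed_field itself \<Rightarrow> nat \<Rightarrow> nat \<Rightarrow> nat list set" where
  "straightening_indices _ n r = {I \<in> tuples n r. \<not> admissible n r I \<and>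
     \<not> vanishes_on r (schubert_var n r (ws n r)) (pvar I :: 'a ppoly)}"

text \<open>The difference of the two sides of the relation \<open>p_I = (\<Sum>S. a_S p_S)\<close>.\<close>

definition straightening_form ::
    "nat \<Rightarrow> nat \<Rightarrow> nat list \<Rightarrow> (nat list \<Rightarrow> 'a::field) \<Rightarrow> 'a ppoly" where
  "straightening_form n r I a =
     pvar I - (\<Sum>S | S \<in> tuples n r \<and> admissible n r S. pconst (a S) * pvar S)"

text \<open>The Pluecker coordinates that vanish identically on \<open>X\<close>, i.e. the relations \<open>p_J = 0\<close> on \<open>X\<close>.\<close>

definition vanishing_coords :: "nat \<Rightarrow> nat \<Rightarrow> (nat \<Rightarrow> 'a::field) set set \<Rightarrow> 'a ppoly set" where
  "vanishing_coords n r X = {pvar J | J. J \<in> tuples n r \<and> vanishes_on r X (pvar J)}"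

end

theory Submission
  imports Defs
begin

text \<open>
  If \<open>W\<close> is \<open>t\<close>-stable then \<open>1 + z t\<close> acts on \<open>W\<close> with determinant \<open>1\<close>, so for every tuple \<open>J\<close> and every
  \<open>d > 0\<close> the sum of the Pluecker coordinates obtained by lowering \<open>d\<close> entries of \<open>J\<close> by \<open>n\<close> vanishes at
  \<open>W\<close>.  These shuffle relations express every \<open>p\<^sub>I\<close> through admissible ones, on all \<open>t\<close>-stable subspaces
  at once and in any characteristic.

  Conversely, evaluate the admissible \<open>p\<^sub>S\<close> with \<open>S \<ge> \<tau>\<^sub>l\<close> along a curve in the cell of \<open>\<tau>\<^sub>l\<close> whose generating
  vector has the coordinates \<open>y ^ w d\<close>, with \<open>w\<close> growing fast.  The lowest term of the minor is its
  diagonal term, and the resulting orders in \<open>y\<close> are pairwise distinct.  Hence these \<open>p\<^sub>S\<close> are linearly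
  independent on \<open>X(\<tau>\<^sub>l)\<close>, while all other admissible coordinates vanish there.  Since linear forms
  vanish on the closure of a cell if and only if they vanish on the cell, no further geometry of
  Schubert varieties is needed.
\<close>

subsection \<open>Minors and shuffle relations\<close>

text \<open>Rows are selected by an arbitrary function because lowering entries of a tuple produces
  unsorted, repeated and zero indices. Entries in a commutative ring allow polynomial
  matrices.\<close>

definition minor :: "nat \<Rightarrow> (nat \<Rightarrow> nat \<Rightarrow> 'a::comm_ring_1) \<Rightarrow> (nat \<Rightarrow> nat) \<Rightarrow> 'a" where
  "minor r b i = det (mat r r (\<lambda>(k, l). b l (i k)))"

lemma plucker_minor: "plucker r b I = minor r b ((!) I)"
  by (simp add: plucker_def minor_def)

lemma minor_leibniz:
  "minor r b i = (\<Sum>\<sigma> | \<sigma> permutes {0..<r}. signof \<sigma> * (\<Prod>k = 0..<r. b (\<sigma> k) (i k)))"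
proof -
  have "minor r b i = (\<Sum>\<sigma> | \<sigma> permutes {0..<r}. signof \<sigma> *
      (\<Prod>k = 0..<r. mat r r (\<lambda>(k, l). b l (i k)) $$ (k, \<sigma> k)))"
    by (simp add: minor_def det_def)
  also have "\<dots> = (\<Sum>\<sigma> | \<sigma> permutes {0..<r}. signof \<sigma> * (\<Prod>k = 0..<r. b (\<sigma> k) (i k)))"
    by (intro sum.cong refl arg_cong2[of _ _ _ _ "(*)"] prod.cong) (auto dest: permutes_in_image)
  finally show ?thesis .
qed

lemma minor_cong:
  assumes "\<And>k l. k < r \<Longrightarrow> l < r \<Longrightarrow> b l (i k) = b' l (i' k)"
  shows "minor r b i = minor r b' i'"
  using assms unfolding minor_def by (intro arg_cong[of _ _ det] eq_matI) auto

lemma minor_zero_row: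
  assumes "k < r" "\<And>l. l < r \<Longrightarrow> b l (i k) = 0"
  shows "minor r b i = 0"
  unfolding minor_leibniz
proof (intro sum.neutral ballI)
  fix \<sigma> assume "\<sigma> \<in> {\<sigma>. \<sigma> permutes {0..<r}}"
  then have "\<sigma> k < r" using assms(1) permutes_in_image[of \<sigma> "{0..<r}" k] by auto
  then have "(\<Prod>k = 0..<r. b (\<sigma> k) (i k)) = 0"
    using assms by (intro prod_zero bexI[of _ k]) auto
  then show "signof \<sigma> * (\<Prod>k = 0..<r. b (\<sigma> k) (i k)) = 0" by simp
qed

lemma minor_repeated_row:
  assumes "k < r" "k' < r" "k \<noteq> k'" "i k = i k'"
  shows "minor r b i = 0"
  unfolding minor_def
  by (rule det_identical_rows[of _ r k k']) (use assms in \<open>auto simp: row_def\<close>)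

lemma minor_permute_rows:
  assumes "\<sigma> permutes {0..<r}"
  shows "minor r b (i \<circ> \<sigma>) = signof \<sigma> * minor r b i"
proof -
  have "minor r b (i \<circ> \<sigma>) = det (mat r r (\<lambda>(k, l). mat r r (\<lambda>(k, l). b l (i k)) $$ (\<sigma> k, l)))"
    unfolding minor_def using permutes_in_image[OF assms]
    by (intro arg_cong[of _ _ det] eq_matI) auto
  then show ?thesis
    using det_permute_rows[OF _ assms, of "mat r r (\<lambda>(k, l). b l (i k))"] by (simp add: minor_def)
qed

lemma minor_mult_cols:
  assumes "\<And>k l. k < r \<Longrightarrow> l < r \<Longrightarrow> b' l (i k) = (\<Sum>l'<r. b l' (i k) * c l' l)"
  shows "minor r b' i = minor r b i * det (mat r r (\<lambda>(l', l). c l' l))"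
proof -
  have "mat r r (\<lambda>(k, l). b' l (i k)) = mat r r (\<lambda>(k, l). b l (i k)) * mat r r (\<lambda>(l', l). c l' l)"
    by (intro eq_matI) (auto simp: scalar_prod_def assms lessThan_atLeast0 intro!: sum.cong)
  then show ?thesis unfolding minor_def by (simp add: det_mult[of _ r])
qed

lemma coeff_prod_linear:
  fixes f g :: "'b \<Rightarrow> 'a::comm_ring_1"
  assumes "finite A"
  shows "coeff (\<Prod>k\<in>A. [:f k, g k:]) d =
    (\<Sum>K | K \<subseteq> A \<and> card K = d. (\<Prod>k\<in>A. if k \<in> K then g k else f k))"
proof -
  have monom_prod: "(\<Prod>k\<in>K. monom (g k) (Suc 0)) = monom (\<Prod>k\<in>K. g k) (card K)" if "finite K" for K
    using that by (induction K rule: finite_induct) (auto simp: mult_monom)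
  have const_prod: "(\<Prod>k\<in>K. [:f k:]) = [:\<Prod>k\<in>K. f k:]" for K
    by (induction K rule: infinite_finite_induct) auto
  have split: "(\<Prod>k\<in>A. if k \<in> K then g k else f k) = (\<Prod>k\<in>K. g k) * (\<Prod>k\<in>A - K. f k)"
    if "K \<subseteq> A" for K
    using that assms by (simp add: prod.If_cases Int_absorb1 Diff_eq flip: Compl_eq_Diff_UNIV)
  have "(\<Prod>k\<in>A. [:f k, g k:]) = (\<Prod>k\<in>A. monom (g k) 1 + [:f k:])"
    by (simp add: monom_altdef)
  also have "\<dots> = (\<Sum>K\<in>Pow A. monom (\<Prod>k\<in>K. g k) (card K) * [:\<Prod>k\<in>A - K. f k:])"
    using assms
    by (subst prod_add) (auto intro!: sum.cong simp: monom_prod const_prod dest: finite_subset)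
  also have "coeff \<dots> d = (\<Sum>K\<in>Pow A. if card K = d then (\<Prod>k\<in>K. g k) * (\<Prod>k\<in>A - K. f k) else 0)"
    by (simp add: coeff_sum mult.commute[of "monom _ _"])
      (intro sum.cong refl, auto simp: mult.commute)
  also have "\<dots> = (\<Sum>K | K \<subseteq> A \<and> card K = d. (\<Prod>k\<in>A. if k \<in> K then g k else f k))"
    using assms by (intro sum.mono_neutral_cong_right) (auto simp: split)
  finally show ?thesis .
qed

text \<open>Coordinate \<open>k - n\<close> of a vector \<open>v\<close> is coordinate
  \<open>k\<close> of \<open>t v\<close>. For \<open>k \<le> n\<close> the truncated difference is
  \<open>0\<close>, an index outside \<open>{1..r * n}\<close> that stands for a zero row.\<close>

definition lower_rows :: "nat \<Rightarrow> nat set \<Rightarrow> (nat \<Rightarrow> nat) \<Rightarrow> nat \<Rightarrow> nat" where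
  "lower_rows n K i = (\<lambda>k. if k \<in> K then i k - n else i k)"

text \<open>The columns on the left are \<open>(1 + z t) b l\<close> with \<open>z\<close> an
  indeterminate. Expanding every row by multilinearity, a term of degree \<open>d\<close> comes from
  the set \<open>K\<close> of the \<open>d\<close> rows in which \<open>z t\<close> is
  chosen.\<close>

lemma coeff_minor_linear:
  fixes b :: "nat \<Rightarrow> nat \<Rightarrow> 'a::comm_ring_1"
  shows "coeff (minor r (\<lambda>l k. [:b l k, b l (k - n):]) i) d =
    (\<Sum>K | K \<subseteq> {..<r} \<and> card K = d. minor r b (lower_rows n K i))"
proof -
  have sgn: "signof \<sigma> * p = smult (signof \<sigma>) p" for \<sigma> and p :: "'a poly"
    by (simp add: sign_def)
  have "coeff (minor r (\<lambda>l k. [:b l k, b l (k - n):]) i) d =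
    (\<Sum>\<sigma> | \<sigma> permutes {0..<r}. signof \<sigma> * (\<Sum>K | K \<subseteq> {0..<r} \<and> card K = d.
      (\<Prod>k = 0..<r. if k \<in> K then b (\<sigma> k) (i k - n) else b (\<sigma> k) (i k))))"
    unfolding minor_leibniz sgn coeff_sum coeff_smult by (simp add: coeff_prod_linear)
  also have "\<dots> = (\<Sum>K | K \<subseteq> {0..<r} \<and> card K = d. \<Sum>\<sigma> | \<sigma> permutes {0..<r}. signof \<sigma> *
      (\<Prod>k = 0..<r. if k \<in> K then b (\<sigma> k) (i k - n) else b (\<sigma> k) (i k)))"
    unfolding sum_distrib_left by (rule sum.swap)
  also have "\<dots> = (\<Sum>K | K \<subseteq> {..<r} \<and> card K = d. minor r b (lower_rows n K i))"
    unfolding minor_leibniz lower_rows_def lessThan_atLeast0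
    by (intro sum.cong refl arg_cong2[of _ _ _ _ "(*)"] prod.cong) auto
  finally show ?thesis .
qed

text \<open>In the frame \<open>b\<close> multiplication by \<open>t\<close> has the strictly
  triangular matrix \<open>N\<close>. Straightening uses nothing else about a frame, so it applies
  to all cells of the chain at once.\<close>

definition shift_triangular :: "nat \<Rightarrow> nat \<Rightarrow> (nat \<Rightarrow> nat \<Rightarrow> 'a::comm_ring_1) \<Rightarrow> bool" where
  "shift_triangular n r b \<longleftrightarrow> (\<forall>l<r. b l 0 = 0) \<and>
     (\<exists>N. \<forall>l<r. \<forall>k\<le>r * n. b l (k - n) = (\<Sum>l' | l < l' \<and> l' < r. N l' l * b l' k))"

text \<open>The operator \<open>1 + z t\<close> has a unitriangular matrix in the frame
  \<open>b\<close>, so it multiplies every maximal minor by \<open>1\<close>. The minor of the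
  transformed frame is therefore constant in \<open>z\<close>.\<close>

lemma shuffle_relation:
  fixes b :: "nat \<Rightarrow> nat \<Rightarrow> 'a::comm_ring_1"
  assumes b: "shift_triangular n r b" and i: "\<And>k. k < r \<Longrightarrow> i k \<le> r * n" and d: "d > 0"
  shows "(\<Sum>K | K \<subseteq> {..<r} \<and> card K = d. minor r b (lower_rows n K i)) = 0"
proof -
  obtain N where N: "\<And>l k. l < r \<Longrightarrow> k \<le> r * n \<Longrightarrow>
      b l (k - n) = (\<Sum>l' | l < l' \<and> l' < r. N l' l * b l' k)"
    using b unfolding shift_triangular_def by blast
  \<comment> \<open>\<open>U\<close> is the matrix of \<open>1 + z t\<close> in the frame
    \<open>b\<close>.\<close>
  define U where "U = (\<lambda>l' l. if l' = l then 1 else if l < l' then [:0, N l' l:] else 0)"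
  have "minor r (\<lambda>l k. [:b l k, b l (k - n):]) i =
    minor r (\<lambda>l k. [:b l k:]) i * det (mat r r (\<lambda>(l', l). U l' l))"
  proof (rule minor_mult_cols)
    fix k l assume kl: "k < r" "l < r"
    have "(\<Sum>l'<r. [:b l' (i k):] * U l' l) =
      (\<Sum>l'\<in>{l} \<union> {l'. l < l' \<and> l' < r}. [:b l' (i k):] * U l' l)"
      using kl by (intro sum.mono_neutral_right) (auto simp: U_def)
    also have "\<dots> = [:b l (i k):] + (\<Sum>l' | l < l' \<and> l' < r. [:0, N l' l * b l' (i k):])"
      by (subst sum.union_disjoint) (auto simp: U_def mult.commute intro!: sum.cong)
    also have "(\<Sum>l' | l < l' \<and> l' < r. [:0, N l' l * b l' (i k):]) = [:0, b l (i k - n):]"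
      using kl i[of k]
      by (intro poly_eqI) (auto simp: coeff_sum coeff_pCons N split: nat.splits)
    finally show "[:b l (i k), b l (i k - n):] = (\<Sum>l'<r. [:b l' (i k):] * U l' l)" by simp
  qed
  also have "det (mat r r (\<lambda>(l', l). U l' l)) = 1"
  proof -
    have "diag_mat (mat r r (\<lambda>(l', l). U l' l)) = replicate r 1"
      by (intro nth_equalityI) (auto simp: diag_mat_def U_def)
    then show ?thesis
      by (subst det_lower_triangular[of r]) (auto simp: U_def)
  qed
  also have "minor r (\<lambda>l k. [:b l k:]) i = [:minor r b i:]"
  proof -
    have "comm_ring_hom (\<lambda>c::'a. [:c:])" by unfold_locales (auto simp: one_pCons)
    note hom = comm_ring_hom.hom_det[OF this, of "mat r r (\<lambda>(k, l). b l (i k))"]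
    show ?thesis unfolding minor_def hom[symmetric] by (intro arg_cong[of _ _ det] eq_matI) auto
  qed
  finally have "coeff (minor r (\<lambda>l k. [:b l k, b l (k - n):]) i) d = coeff [:minor r b i:] d"
    by simp
  then show ?thesis using d unfolding coeff_minor_linear by (cases d) auto
qed

subsection \<open>Straightening\<close>

text \<open>Exchange argument: \<open>{..<a} - K\<close> and \<open>K - {..<a}\<close> have the same
  size, and \<open>J\<close> is below \<open>J a\<close> on the former and at least
  \<open>J a\<close> on the latter.\<close>

lemma sum_strict_mono_initial_less:
  fixes J :: "nat \<Rightarrow> nat"
  assumes J: "\<And>k k'. k < k' \<Longrightarrow> k' < r \<Longrightarrow> J k < J k'"
    and K: "K \<subseteq> {..<r}" "card K = a" "K \<noteq> {..<a}"
  shows "sum J {..<a} < sum J K"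
proof -
  have fin: "finite K" using K(1) finite_subset by blast
  have "\<not> K \<subseteq> {..<a}"
    using K(2,3) card_subset_eq[OF finite_lessThan, of K a] by (metis card_lessThan)
  then obtain x where "x \<in> K" "x \<notin> {..<a}" by blast
  then have x: "x \<in> K" "a \<le> x" by simp_all
  then have a: "a < r" using K(1) by auto
  have card: "card ({..<a} - K) = card (K - {..<a})"
    using K(2) fin card_Diff_subset_Int[of "{..<a}" K] card_Diff_subset_Int[of K "{..<a}"]
    by (simp add: Int_commute)
  have pos: "card (K - {..<a}) > 0" using x fin by (auto simp: card_gt_0_iff)
  have "sum J ({..<a} - K) < sum (\<lambda>_. J a) ({..<a} - K)"
    using pos a unfolding card[symmetric] card_gt_0_iff by (intro sum_strict_mono) (auto simp: J)
  also have "\<dots> = sum (\<lambda>_. J a) (K - {..<a})" by (simp add: card)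
  also have "\<dots> \<le> sum J (K - {..<a})"
  proof (intro sum_mono)
    fix k assume "k \<in> K - {..<a}"
    then have "k < r" "a \<le> k" using K(1) by auto
    then show "J a \<le> J k" using J[of a k] by (cases "a = k") auto
  qed
  finally have "sum J ({..<a} - K) < sum J (K - {..<a})" .
  moreover have "sum J {..<a} = sum J ({..<a} \<inter> K) + sum J ({..<a} - K)"
    by (rule sum.Int_Diff) simp
  moreover have "sum J K = sum J ({..<a} \<inter> K) + sum J (K - {..<a})"
    unfolding Int_commute[of "{..<a}" K] using fin by (rule sum.Int_Diff)
  ultimately show ?thesis by linarith
qed

text \<open>Since \<open>(x - n)^2 = x^2 - 2 n x + n^2\<close>, for sets \<open>K\<close> of fixed
  size the sum of squares depends only on \<open>sum J K\<close>, which is least for the initial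
  segment.\<close>

lemma sum_squares_lower_rows_less:
  fixes J :: "nat \<Rightarrow> nat"
  assumes J: "\<And>k k'. k < k' \<Longrightarrow> k' < r \<Longrightarrow> J k < J k'"
    and n: "n > 0" "\<And>k. k < a \<Longrightarrow> n \<le> J k"
    and K: "K \<subseteq> {..<r}" "card K = a" "K \<noteq> {..<a}"
  shows "(\<Sum>k<r. (lower_rows n K J k)\<^sup>2) < (\<Sum>k<r. (lower_rows n {..<a} J k)\<^sup>2)"
proof -
  have a: "a \<le> r" using K(1,2) card_mono[of "{..<r}" K] by auto
  have expand: "(\<Sum>k<r. if k \<in> A then (int (J k) - int n)\<^sup>2 else (int (J k))\<^sup>2) =
     (\<Sum>k<r. (int (J k))\<^sup>2) - 2 * int n * int (sum J A) + (int n)\<^sup>2 * int (card A)"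
    if "A \<subseteq> {..<r}" for A
  proof -
    have "(\<Sum>k<r. if k \<in> A then (int (J k) - int n)\<^sup>2 else (int (J k))\<^sup>2) =
      (\<Sum>k<r. (int (J k))\<^sup>2 + (if k \<in> A then (int n)\<^sup>2 - 2 * int n * int (J k) else 0))"
      by (intro sum.cong) (auto simp: power2_eq_square algebra_simps)
    also have "\<dots> = (\<Sum>k<r. (int (J k))\<^sup>2) + (\<Sum>k\<in>A. (int n)\<^sup>2 - 2 * int n * int (J k))"
      using that by (simp add: sum.distrib sum.If_cases Int_absorb1)
    finally show ?thesis by (simp add: sum_subtractf sum_distrib_left)
  qed
  \<comment> \<open>For \<open>J k < n\<close> truncation replaces \<open>(J k - n)^2\<close> by
    \<open>0\<close>, so for \<open>K\<close> there is only an inequality; for \<open>{..<a}\<close>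
    the bound \<open>n \<le> J k\<close> gives equality.\<close>
  have "int (\<Sum>k<r. (lower_rows n K J k)\<^sup>2) \<le>
      (\<Sum>k<r. if k \<in> K then (int (J k) - int n)\<^sup>2 else (int (J k))\<^sup>2)"
    unfolding of_nat_sum
  proof (intro sum_mono)
    fix k
    show "int ((lower_rows n K J k)\<^sup>2) \<le> (if k \<in> K then (int (J k) - int n)\<^sup>2 else (int (J k))\<^sup>2)"
      by (cases "n \<le> J k") (auto simp: lower_rows_def of_nat_diff)
  qed
  also have "\<dots> = (\<Sum>k<r. (int (J k))\<^sup>2) - 2 * int n * int (sum J K) + (int n)\<^sup>2 * int a"
    using expand[of K] K by simp
  also have "\<dots> < (\<Sum>k<r. (int (J k))\<^sup>2) - 2 * int n * int (sum J {..<a}) + (int n)\<^sup>2 * int a"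
  proof -
    have "sum J {..<a} < sum J K" by (rule sum_strict_mono_initial_less[OF J K])
    then have "int n * int (sum J {..<a}) < int n * int (sum J K)"
      using n(1) by (intro mult_strict_left_mono) (simp_all only: of_nat_less_iff of_nat_0_less_iff)
    then show ?thesis by linarith
  qed
  also have "\<dots> = (\<Sum>k<r. if k \<in> {..<a} then (int (J k) - int n)\<^sup>2 else (int (J k))\<^sup>2)"
    using expand[of "{..<a}"] a by simp
  also have "\<dots> = int (\<Sum>k<r. (lower_rows n {..<a} J k)\<^sup>2)"
    unfolding of_nat_sum using n(2) by (intro sum.cong) (auto simp: lower_rows_def of_nat_diff)
  finally show ?thesis by linarith
qed

section \<open>Strictly increasing tuples and sorting of row indices\<close>

lemma finite_tuples: "finite (tuples n r)"
proof (rule finite_subset)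
  show "tuples n r \<subseteq> {I. set I \<subseteq> {1..r * n} \<and> length I = r}" by (auto simp: tuples_def)
qed (simp add: finite_lists_length_eq)

lemma tuplesD:
  assumes "I \<in> tuples n r"
  shows "length I = r" "\<And>k. k < r \<Longrightarrow> 1 \<le> I ! k" "\<And>k. k < r \<Longrightarrow> I ! k \<le> r * n"
    "\<And>k k'. k < k' \<Longrightarrow> k' < r \<Longrightarrow> I ! k < I ! k'"
proof -
  show len: "length I = r" using assms by (simp add: tuples_def)
  have "I ! k \<in> {1..r * n}" if "k < r" for k
    using assms that len nth_mem[of k I] unfolding tuples_def by blast
  then show "\<And>k. k < r \<Longrightarrow> 1 \<le> I ! k" "\<And>k. k < r \<Longrightarrow> I ! k \<le> r * n" by auto
  show "\<And>k k'. k < k' \<Longrightarrow> k' < r \<Longrightarrow> I ! k < I ! k'"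
    using assms len by (auto simp: tuples_def intro: sorted_wrt_nth_less)
qed

lemma inj_rows_sorted:
  assumes inj: "inj_on i {..<r}" and range: "\<And>k. k < r \<Longrightarrow> i k \<in> {1..r * n}"
  obtains S \<sigma> where "S \<in> tuples n r" "\<sigma> permutes {0..<r}" "\<And>k. k < r \<Longrightarrow> S ! k = i (\<sigma> k)"
proof -
  define S where "S = sorted_list_of_set (i ` {..<r})"
  have len: "length S = r" using inj by (simp add: S_def card_image)
  have set: "set S = i ` {..<r}" by (simp add: S_def)
  have dist: "distinct S" by (simp add: S_def)
  have S: "S \<in> tuples n r" using range len set by (auto simp: tuples_def S_def)
  define \<sigma> where "\<sigma> = (\<lambda>k. if k < r then the_inv_into {..<r} i (S ! k) else k)"
  have bij: "bij_betw i {..<r} (set S)" using inj set by (simp add: bij_betw_def)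
  have "bij_betw ((!) S) {..<r} (set S)" using bij_betw_nth[OF dist] len by simp
  then have "bij_betw (the_inv_into {..<r} i \<circ> (!) S) {..<r} {..<r}"
    using bij_betw_the_inv_into[OF bij] by (rule bij_betw_trans)
  then have "bij_betw \<sigma> {..<r} {..<r}"
    by (rule bij_betw_cong[THEN iffD1, rotated]) (simp add: \<sigma>_def)
  then have "\<sigma> permutes {0..<r}"
    by (intro bij_imp_permutes) (auto simp: \<sigma>_def lessThan_atLeast0)
  moreover have "S ! k = i (\<sigma> k)" if "k < r" for k
    using that f_the_inv_into_f[OF inj, of "S ! k"] set len nth_mem[of k S] by (simp add: \<sigma>_def)
  ultimately show ?thesis using that S by blast
qed


text \<open>The coefficients are chosen before the frame. This uniformity later carries relations
  from the cell of \<open>w_s\<close> to every cell of the chain.\<close>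

definition straightens :: "nat \<Rightarrow> nat \<Rightarrow> ((nat \<Rightarrow> nat \<Rightarrow> 'a::comm_ring_1) \<Rightarrow> 'a) \<Rightarrow> bool" where
  "straightens n r f \<longleftrightarrow> (\<exists>a. \<forall>b. shift_triangular n r b \<longrightarrow>
     f b = (\<Sum>S | S \<in> tuples n r \<and> admissible n r S. a S * minor r b ((!) S)))"

lemma straightens_cong:
  assumes "straightens n r f" "\<And>b. shift_triangular n r b \<Longrightarrow> g b = f b"
  shows "straightens n r g"
  using assms unfolding straightens_def by simp

lemma straightens_zero: "straightens n r (\<lambda>b. 0)"
  unfolding straightens_def by (intro exI[of _ "\<lambda>_. 0"]) simp

lemma straightens_add:
  assumes "straightens n r f" "straightens n r g"
  shows "straightens n r (\<lambda>b. f b + g b)"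
proof -
  obtain a where a: "\<forall>b. shift_triangular n r b \<longrightarrow>
      f b = (\<Sum>S | S \<in> tuples n r \<and> admissible n r S. a S * minor r b ((!) S))"
    using assms(1) unfolding straightens_def ..
  obtain a' where a': "\<forall>b. shift_triangular n r b \<longrightarrow>
      g b = (\<Sum>S | S \<in> tuples n r \<and> admissible n r S. a' S * minor r b ((!) S))"
    using assms(2) unfolding straightens_def ..
  show ?thesis unfolding straightens_def
    by (intro exI[of _ "\<lambda>S. a S + a' S"]) (simp add: a a' distrib_right sum.distrib)
qed

lemma straightens_scale:
  assumes "straightens n r f"
  shows "straightens n r (\<lambda>b. c * f b)"
proof -
  obtain a where a: "\<forall>b. shift_triangular n r b \<longrightarrow>
      f b = (\<Sum>S | S \<in> tuples n r \<and> admissible n r S. a S * minor r b ((!) S))"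
    using assms unfolding straightens_def ..
  show ?thesis unfolding straightens_def
    by (intro exI[of _ "\<lambda>S. c * a S"]) (simp add: a sum_distrib_left mult.assoc)
qed

lemma straightens_sum:
  assumes "\<And>x. x \<in> A \<Longrightarrow> straightens n r (f x)"
  shows "straightens n r (\<lambda>b. \<Sum>x\<in>A. f x b)"
  using assms
  by (induction A rule: infinite_finite_induct) (auto intro: straightens_zero straightens_add)

lemma straightens_admissible:
  assumes "S \<in> tuples n r" "admissible n r S"
  shows "straightens n r (\<lambda>b. minor r b ((!) S))"
proof -
  let ?A = "{S. S \<in> tuples n r \<and> admissible n r S}"
  have delta: "minor r b ((!) S) = (\<Sum>S'\<in>?A. (if S' = S then 1 else 0) * minor r b ((!) S'))"
    for b :: "nat \<Rightarrow> nat \<Rightarrow> 'a::comm_ring_1"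
  proof -
    have "(\<Sum>S'\<in>?A. (if S' = S then 1 else 0) * minor r b ((!) S')) =
        (\<Sum>S'\<in>?A. if S' = S then minor r b ((!) S') else 0)"
      by (intro sum.cong) auto
    then show ?thesis using assms finite_tuples[of n r] by simp
  qed
  show ?thesis unfolding straightens_def
    by (intro exI[of _ "\<lambda>S'. if S' = S then 1 else 0"] allI impI delta)
qed

text \<open>
  If the gap after the first \<open>a\<close> entries of \<open>I\<close> exceeds \<open>n\<close>, raise these entries by \<open>n\<close>.  The
  shuffle relation that lowers \<open>a\<close> entries again contains \<open>p_I\<close> once; every other term lowers an
  entry to the right instead and therefore has a smaller sum of squares.
\<close>

lemma minor_straightens:
  assumes n: "n > 0" and range: "\<And>k. k < r \<Longrightarrow> i k \<le> r * n"
  shows "straightens n r (\<lambda>b :: nat \<Rightarrow> nat \<Rightarrow> 'a::comm_ring_1. minor r b i)"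
  using range
proof (induction "\<Sum>k<r. (i k)\<^sup>2" arbitrary: i rule: less_induct)
  case less
  consider (zero) k where "k < r" "i k = 0" | (rep) "\<not> inj_on i {..<r}"
    | (inj) "inj_on i {..<r}" "\<forall>k<r. i k > 0" by blast
  then show ?case
  proof cases
    case zero
    then show ?thesis
      by (intro straightens_cong[OF straightens_zero] minor_zero_row)
        (auto simp: shift_triangular_def)
  next
    case rep
    then obtain k k' where "k < r" "k' < r" "k \<noteq> k'" "i k = i k'" by (auto simp: inj_on_def)
    then show ?thesis
      by (intro straightens_cong[OF straightens_zero] minor_repeated_row)
  next
    case inj
    then obtain S \<sigma> where S: "S \<in> tuples n r" and \<sigma>: "\<sigma> permutes {0..<r}"
      and S\<sigma>: "\<And>k. k < r \<Longrightarrow> S ! k = i (\<sigma> k)"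
      using inj_rows_sorted[of i r n] less.prems by (auto simp: Suc_le_eq)
    have "minor r b i = signof \<sigma> * minor r b ((!) S)" for b :: "nat \<Rightarrow> nat \<Rightarrow> 'a"
    proof -
      have "minor r b ((!) S) = minor r b (i \<circ> \<sigma>)" by (intro minor_cong) (simp add: S\<sigma>)
      then show ?thesis using minor_permute_rows[OF \<sigma>, of b i] by (simp add: sign_def)
    qed
    moreover have "straightens n r (\<lambda>b :: nat \<Rightarrow> nat \<Rightarrow> 'a. minor r b ((!) S))"
    proof (cases "admissible n r S")
      case True
      then show ?thesis using S by (rule straightens_admissible[rotated])
    next
      case False
      then obtain c where c: "seq_ext n r S c + n < seq_ext n r S (Suc c)"
        unfolding admissible_def by (auto simp: not_le)
      then have cr: "c < r" using n by (auto simp: seq_ext_def split: if_splits)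
      define a where "a = Suc c"
      define J where "J = (\<lambda>k. if k < a then S ! k + n else S ! k)"
      \<comment> \<open>If the gap follows the last entry, then \<open>a = r\<close> and the next
        entry of the infinite sequence is \<open>r n + 1\<close>, so raised entries still do not
        exceed \<open>r n\<close>.\<close>
      have gap: "S ! c + n < (if a < r then S ! a else r * n + 1)"
        using c cr by (auto simp: seq_ext_def a_def split: if_splits)
      have J_mono: "J k < J k'" if "k < k'" "k' < r" for k k'
      proof -
        have less: "S ! k < S ! k'" by (rule tuplesD(4)[OF S that])
        show ?thesis
        proof (cases "k < a \<and> a \<le> k'")
          case True
          then have "k = c \<or> k < c" "a = k' \<or> a < k'" by (auto simp: a_def)
          then have "S ! k \<le> S ! c" "S ! a \<le> S ! k'"
            using tuplesD(4)[OF S _ cr, of k] tuplesD(4)[OF S _ that(2), of a] by fastforce+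
          moreover have "S ! c + n < S ! a" using gap True that(2) by simp
          ultimately show ?thesis using True by (simp add: J_def)
        next
          case False
          then show ?thesis using less that(1) by (auto simp: J_def)
        qed
      qed
      have J_le: "J k \<le> r * n" if "k < r" for k
      proof (cases "k < a")
        case True
        have "k = c \<or> k < c" using True by (auto simp: a_def)
        then have "S ! k \<le> S ! c" using tuplesD(4)[OF S _ cr, of k] by fastforce
        moreover have "S ! c + n \<le> r * n"
          using gap tuplesD(3)[OF S, of a] by (cases "a < r") auto
        ultimately show ?thesis using True by (simp add: J_def)
      qed (use that tuplesD(3)[OF S] in \<open>auto simp: J_def\<close>)
      have low: "lower_rows n {..<a} J = (!) S" by (auto simp: lower_rows_def J_def)
      \<comment> \<open>Sorting preserves the induction measure, so the hypothesis for
        \<open>i\<close> covers all terms smaller than \<open>S\<close>.\<close>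
      have squares: "(\<Sum>k<r. (S ! k)\<^sup>2) = (\<Sum>k<r. (i k)\<^sup>2)"
        using sum.permute[OF \<sigma>, of "\<lambda>k. (i k)\<^sup>2"] by (simp add: S\<sigma> lessThan_atLeast0)
      let ?Ks = "{K. K \<subseteq> {..<r} \<and> card K = a}"
      have "straightens n r (\<lambda>b :: nat \<Rightarrow> nat \<Rightarrow> 'a. minor r b (lower_rows n K J))"
        if "K \<in> ?Ks - {{..<a}}" for K
      proof (rule less.hyps)
        show "(\<Sum>k<r. (lower_rows n K J k)\<^sup>2) < (\<Sum>k<r. (i k)\<^sup>2)"
          using sum_squares_lower_rows_less[of r J n a K] J_mono n that
          by (simp add: low squares) (simp add: J_def)
        show "lower_rows n K J k \<le> r * n" if "k < r" for k
          using J_le[OF that] by (auto simp: lower_rows_def)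
      qed
      then have "straightens n r (\<lambda>b :: nat \<Rightarrow> nat \<Rightarrow> 'a.
          -1 * (\<Sum>K\<in>?Ks - {{..<a}}. minor r b (lower_rows n K J)))"
        by (intro straightens_scale straightens_sum)
      then show ?thesis
      proof (rule straightens_cong)
        fix b :: "nat \<Rightarrow> nat \<Rightarrow> 'a" assume "shift_triangular n r b"
        then have "(\<Sum>K\<in>?Ks. minor r b (lower_rows n K J)) = 0"
          using J_le by (intro shuffle_relation) (auto simp: a_def)
        moreover have "(\<Sum>K\<in>?Ks. minor r b (lower_rows n K J)) =
            minor r b ((!) S) + (\<Sum>K\<in>?Ks - {{..<a}}. minor r b (lower_rows n K J))"
          unfolding low[symmetric] using cr by (intro sum.remove) (auto simp: a_def)
        ultimately show "minor r b ((!) S) = -1 * (\<Sum>K\<in>?Ks - {{..<a}}. minor r b (lower_rows n K J))"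
          by (simp add: add_eq_0_iff2)
      qed
    qed
    ultimately show ?thesis by (simp add: straightens_scale)
  qed
qed

subsection \<open>Linear forms in the Pluecker coordinates\<close>

lemma peval_superset:
  assumes "finite A" "Poly_Mapping.keys P \<subseteq> A"
  shows "peval x P = (\<Sum>m\<in>A. Poly_Mapping.lookup P m *
     (\<Prod>I\<in>Poly_Mapping.keys m. x I ^ Poly_Mapping.lookup m I))"
  unfolding peval_def using assms by (intro sum.mono_neutral_left) (auto simp: in_keys_iff)

lemma peval_add: "peval x (P + Q) = peval x P + peval x Q"
proof -
  let ?A = "Poly_Mapping.keys P \<union> Poly_Mapping.keys Q"
  have "Poly_Mapping.keys (P + Q) \<subseteq> ?A" by (rule keys_add)
  then show ?thesis
    by (simp add: peval_superset[of ?A] lookup_add algebra_simps sum.distrib)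
qed

lemma lookup_pconst_mult: "Poly_Mapping.lookup (pconst c * P) m = c * Poly_Mapping.lookup P m"
  unfolding pconst_def mult_map_scale_conv_mult[symmetric] by (simp add: map.rep_eq when_def)

lemma keys_pconst_mult: "Poly_Mapping.keys (pconst c * P) \<subseteq> Poly_Mapping.keys P"
  by (auto simp: in_keys_iff lookup_pconst_mult)

lemma peval_pconst_mult: "peval x (pconst c * P) = c * peval x P"
  by (subst peval_superset[OF finite_keys keys_pconst_mult])
    (simp add: lookup_pconst_mult peval_def sum_distrib_left mult.assoc)

lemma peval_pvar: "peval x (pvar I) = x I"
  by (simp add: peval_def pvar_def)

lemma peval_zero: "peval x 0 = 0"
  by (simp add: peval_def)

lemma peval_diff: "peval x (P - Q) = peval x P - peval x Q"
  using peval_add[of x "P - Q" Q] by simp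

lemma peval_sum: "peval x (\<Sum>i\<in>A. P i) = (\<Sum>i\<in>A. peval x (P i))"
  by (induction A rule: infinite_finite_induct) (simp_all add: peval_zero peval_add)

lemmas peval_simps = peval_zero peval_add peval_diff peval_sum peval_pconst_mult peval_pvar

lemma pvar_in_hom_polys: "I \<in> tuples n r \<Longrightarrow> pvar I \<in> hom_polys n r 1"
  by (simp add: hom_polys_def pvar_def)

lemma subspace_hom_polys: "ppoly.subspace (hom_polys n r d)"
  unfolding ppoly.subspace_def hom_polys_def
  using keys_add keys_pconst_mult by (fastforce simp: keys_zero)

lemma subspace_ideal_part: "ppoly.subspace (ideal_part n r d X)"
  using subspace_hom_polys[of n r d]
  unfolding ppoly.subspace_def ideal_part_def vanishes_on_def by (auto simp: peval_simps)

definition linear_coeff :: "'a::field ppoly \<Rightarrow> nat list \<Rightarrow> 'a" where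
  "linear_coeff P I = Poly_Mapping.lookup P (Poly_Mapping.single I 1)"

text \<open>The exponents of a monomial of degree one sum to \<open>1\<close>, so exactly one of
  them is \<open>1\<close> and the monomial is an indeterminate.\<close>

lemma hom_polys_1_expand:
  assumes "P \<in> hom_polys n r 1"
  shows "P = (\<Sum>I\<in>tuples n r. pconst (linear_coeff P I) * pvar I)"
proof (rule poly_mapping_eqI)
  fix m
  have rhs: "Poly_Mapping.lookup (\<Sum>I\<in>tuples n r. pconst (linear_coeff P I) * pvar I) m =
      (\<Sum>I\<in>tuples n r. if Poly_Mapping.single I 1 = m then linear_coeff P I else 0)"
    by (auto simp: lookup_sum lookup_pconst_mult pvar_def lookup_single when_def intro!: sum.cong)
  show "Poly_Mapping.lookup P m =
      Poly_Mapping.lookup (\<Sum>I\<in>tuples n r. pconst (linear_coeff P I) * pvar I) m"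
  proof (cases "\<exists>J\<in>tuples n r. m = Poly_Mapping.single J 1")
    case True
    then obtain J where J: "J \<in> tuples n r" "m = Poly_Mapping.single J 1" by blast
    have "Poly_Mapping.single I (1::nat) = Poly_Mapping.single J 1 \<longleftrightarrow> I = J" for I
      by (metis keys_single singleton_inject zero_neq_one)
    then have "(\<Sum>I\<in>tuples n r. if Poly_Mapping.single I 1 = m then linear_coeff P I else 0) =
        (\<Sum>I\<in>tuples n r. if I = J then linear_coeff P I else 0)"
      unfolding J(2) by simp
    also have "\<dots> = Poly_Mapping.lookup P m"
      using J finite_tuples[of n r] by (simp add: linear_coeff_def)
    finally show ?thesis unfolding rhs by simp
  next
    case False
    have "m \<notin> Poly_Mapping.keys P"
    proof
      assume "m \<in> Poly_Mapping.keys P"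
      then have m: "Poly_Mapping.keys m \<subseteq> tuples n r"
          "(\<Sum>I\<in>Poly_Mapping.keys m. Poly_Mapping.lookup m I) = 1"
        using assms by (auto simp: hom_polys_def)
      then obtain J where J: "J \<in> Poly_Mapping.keys m" "Poly_Mapping.lookup m J = 1"
          "\<And>I. I \<in> Poly_Mapping.keys m \<Longrightarrow> J \<noteq> I \<Longrightarrow> Poly_Mapping.lookup m I = 0"
        unfolding sum_eq_1_iff[OF finite_keys] by blast
      have "m = Poly_Mapping.single J 1"
        using J by (intro poly_mapping_eqI) (auto simp: lookup_single when_def in_keys_iff)
      then show False using False J(1) m(1) by blast
    qed
    then show ?thesis unfolding rhs using False
      by (subst sum.neutral) (auto simp: in_keys_iff)
  qed
qed

lemma peval_hom_polys_1:
  assumes "P \<in> hom_polys n r 1"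
  shows "peval x P = (\<Sum>I\<in>tuples n r. linear_coeff P I * x I)"
  by (subst hom_polys_1_expand[OF assms]) (simp add: peval_simps)

lemma straightening_form_in_hom_polys:
  assumes "I \<in> tuples n r"
  shows "straightening_form n r I a \<in> hom_polys n r 1"
  unfolding straightening_form_def
  by (intro ppoly.subspace_diff ppoly.subspace_sum ppoly.subspace_scale subspace_hom_polys
      pvar_in_hom_polys assms) blast

subsection \<open>The Iwahori group acting on the coordinates of \<open>V\<^sub>s\<close>\<close>

lemma sum_fun_apply: "(\<Sum>x\<in>A. f x) k = (\<Sum>x\<in>A. f x k)"
  by (induction A rule: infinite_finite_induct) auto

text \<open>The matrix of \<open>g\<close> on \<open>V_s\<close> in the basis \<open>e_k\<close>.
  The column index has no upper bound, so that \<open>k' + n\<close> is always meaningful; for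
  \<open>k' > r n\<close> the condition on the quotients fails and the entry is
  \<open>0\<close>.\<close>

definition act_entry :: "nat \<Rightarrow> nat \<Rightarrow> 'a::field fps mat \<Rightarrow> nat \<Rightarrow> nat \<Rightarrow> 'a" where
  "act_entry n r g k k' = (if k \<in> {1..r * n} \<and> 1 \<le> k' \<and> (k' - 1) div n \<le> (k - 1) div n
     then fps_nth (g $$ ((k - 1) mod n, (k' - 1) mod n)) ((k - 1) div n - (k' - 1) div n) else 0)"

text \<open>The columns are the images under \<open>g\<close> of the basis vectors of
  \<open>E_T\<close>, taken in the order of \<open>T\<close>.\<close>

definition frame :: "nat \<Rightarrow> nat \<Rightarrow> 'a::field fps mat \<Rightarrow> nat list \<Rightarrow> nat \<Rightarrow> nat \<Rightarrow> 'a" where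
  "frame n r g T = (\<lambda>l k. act_entry n r g k (T ! l))"

text \<open>Within one block of \<open>n\<close> indices, \<open>k < k'\<close> points to an entry
  of \<open>g\<close> above the diagonal, which has positive order. Across blocks the power of
  \<open>t\<close> would be negative.\<close>

lemma act_entry_lower:
  assumes "g \<in> iwahori n" "k < k'"
  shows "act_entry n r g k k' = 0"
proof (cases "k \<in> {1..r * n} \<and> 1 \<le> k' \<and> (k' - 1) div n \<le> (k - 1) div n")
  case True
  then have div: "(k' - 1) div n = (k - 1) div n"
    using div_le_mono[of "k - 1" "k' - 1" n] assms(2) by (intro antisym) simp_all
  have "n > 0" using True by (cases n) auto
  have "(k - 1) mod n < (k' - 1) mod n"
  proof -
    have "k - 1 < k' - 1" using True assms(2) by auto
    moreover have "(k - 1) div n * n + (k - 1) mod n = k - 1" by (rule div_mult_mod_eq)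
    moreover have "(k - 1) div n * n + (k' - 1) mod n = k' - 1"
      unfolding div[symmetric] by (rule div_mult_mod_eq)
    ultimately show ?thesis by linarith
  qed
  then show ?thesis
    using assms(1) div \<open>n > 0\<close> by (simp add: act_entry_def iwahori_def)
qed (auto simp: act_entry_def)

text \<open>Setting \<open>t = 0\<close> is a ring homomorphism and makes \<open>g\<close> lower
  triangular.\<close>

lemma det_fps_nth_0:
  fixes g :: "'a::field fps mat"
  assumes g: "g \<in> carrier_mat n n"
    and upper: "\<And>i j. i < j \<Longrightarrow> j < n \<Longrightarrow> fps_nth (g $$ (i, j)) 0 = 0"
  shows "fps_nth (det g) 0 = (\<Prod>i<n. fps_nth (g $$ (i, i)) 0)"
proof -
  interpret hom: comm_ring_hom "\<lambda>f::'a fps. fps_nth f 0"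
    by unfold_locales (simp_all add: fps_mult_nth_0)
  let ?g = "map_mat (\<lambda>f. fps_nth f 0) g"
  have "fps_nth (det g) 0 = det ?g"
    by (rule hom.hom_det[symmetric])
  also have "\<dots> = prod_list (diag_mat ?g)"
    using g by (intro det_lower_triangular[of n]) (simp_all add: upper)
  also have "diag_mat ?g = map (\<lambda>i. fps_nth (g $$ (i, i)) 0) [0..<n]"
    unfolding diag_mat_def using g by (intro map_cong) simp_all
  also have "prod_list \<dots> = (\<Prod>i<n. fps_nth (g $$ (i, i)) 0)"
    by (simp add: prod.distinct_set_conv_list[symmetric] lessThan_atLeast0)
  finally show ?thesis .
qed

text \<open>The determinant of \<open>g\<close> is a unit, so its constant term, the product of
  those on the diagonal, is nonzero.\<close>

lemma iwahori_diag:
  assumes g: "g \<in> iwahori n" and i: "i < n"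
  shows "fps_nth (g $$ (i, i)) 0 \<noteq> 0"
proof -
  have carrier: "g \<in> carrier_mat n n"
    and upper: "\<And>i j. i < j \<Longrightarrow> j < n \<Longrightarrow> fps_nth (g $$ (i, j)) 0 = 0"
    using g by (simp_all add: iwahori_def)
  obtain B where "inverts_mat g B" "inverts_mat B g"
    using g unfolding iwahori_def invertible_mat_def by blast
  then have gB: "g * B = 1\<^sub>m n" and Bg: "B * g = 1\<^sub>m (dim_row B)"
    using carrier by (simp_all add: inverts_mat_def)
  have "dim_col B = n" using arg_cong[OF gB, of dim_col] by simp
  moreover have "dim_row B = n" using arg_cong[OF Bg, of dim_col] carrier by simp
  ultimately have "B \<in> carrier_mat n n" by blast
  then have "det g * det B = 1" using det_mult[OF carrier, of B] gB by simp
  then have "fps_nth (det g) 0 * fps_nth (det B) 0 = 1"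
    unfolding fps_mult_nth_0[symmetric] by simp
  then have "fps_nth (det g) 0 \<noteq> 0" by auto
  then have "(\<Prod>i<n. fps_nth (g $$ (i, i)) 0) \<noteq> 0"
    using det_fps_nth_0[OF carrier upper] by simp
  then show ?thesis using i by simp
qed

text \<open>The constant terms alone make \<open>det g\<close> a unit of the power series ring, and
  the adjugate then gives the inverse.\<close>

lemma iwahoriI:
  fixes g :: "'a::field fps mat"
  assumes g: "g \<in> carrier_mat n n"
    and upper: "\<And>i j. i < j \<Longrightarrow> j < n \<Longrightarrow> fps_nth (g $$ (i, j)) 0 = 0"
    and diag: "\<And>i. i < n \<Longrightarrow> fps_nth (g $$ (i, i)) 0 \<noteq> 0"
  shows "g \<in> iwahori n"
proof -
  have "fps_nth (det g) 0 \<noteq> 0"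
    using diag by (simp add: det_fps_nth_0[OF g upper])
  then have inv: "inverse (det g) * det g = 1" by (rule inverse_mult_eq_1)
  let ?B = "inverse (det g) \<cdot>\<^sub>m adj_mat g"
  have "g * ?B = inverse (det g) \<cdot>\<^sub>m (det g \<cdot>\<^sub>m 1\<^sub>m n)"
    using mult_smult_distrib[OF g adj_mat(1)[OF g], of "inverse (det g)"] adj_mat(2)[OF g] by simp
  also have "\<dots> = 1\<^sub>m n" by (intro eq_matI) (simp_all add: inv flip: mult.assoc)
  finally have gB: "g * ?B = 1\<^sub>m n" .
  have "?B * g = inverse (det g) \<cdot>\<^sub>m (det g \<cdot>\<^sub>m 1\<^sub>m n)"
    using mult_smult_assoc_mat[OF adj_mat(1)[OF g] g, of "inverse (det g)"] adj_mat(3)[OF g] by simp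
  also have "\<dots> = 1\<^sub>m n" by (intro eq_matI) (simp_all add: inv flip: mult.assoc)
  finally have Bg: "?B * g = 1\<^sub>m n" .
  have "invertible_mat g"
    unfolding invertible_mat_def inverts_mat_def
    using g adj_mat(1)[OF g] gB Bg by (intro conjI exI[of _ ?B]) simp_all
  then show ?thesis using g upper by (simp add: iwahori_def)
qed

lemma act_entry_diag:
  assumes "g \<in> iwahori n" "k \<in> {1..r * n}"
  shows "act_entry n r g k k \<noteq> 0"
proof -
  have "n > 0" using assms(2) by (cases n) auto
  then show ?thesis using assms iwahori_diag[OF assms(1), of "(k - 1) mod n"]
    by (simp add: act_entry_def)
qed

text \<open>Multiplication by \<open>t\<close> commutes with \<open>g\<close>. For
  \<open>k \<le> n\<close> both sides vanish, the left one because its row index is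
  \<open>0\<close>.\<close>

lemma act_entry_shift:
  assumes "n > 0" "1 \<le> k'" "k \<le> r * n"
  shows "act_entry n r g (k - n) k' = act_entry n r g k (k' + n)"
proof (cases "k \<le> n")
  case True
  then have "(k - 1) div n < (k' + n - 1) div n"
  proof -
    have "k' + n - 1 = (k' - 1) + n" "k - 1 < n" using assms True by auto
    then show ?thesis using assms(1) by (simp only: div_add_self2 div_less)
  qed
  then show ?thesis using True by (simp add: act_entry_def)
next
  case False
  define p q where "p = k - n - 1" and "q = k' - 1"
  have "k = p + n + 1" "k' = q + 1" using False assms by (auto simp: p_def q_def)
  then show ?thesis using assms by (auto simp: act_entry_def)
qed

definition act_map :: "nat \<Rightarrow> nat \<Rightarrow> 'a::field fps mat \<Rightarrow> (nat \<Rightarrow> 'a) \<Rightarrow> nat \<Rightarrow> 'a" where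
  "act_map n r g u = (\<lambda>k. \<Sum>k'\<in>{1..r * n}. act_entry n r g k k' * u k')"

text \<open>Under \<open>k' = d n + j + 1\<close> the sum in \<open>act_map\<close> becomes a Cauchy
  product. Only \<open>d \<le> c < r\<close> contribute to coefficient \<open>c\<close>, so
  reduction modulo \<open>t^r\<close> loses nothing.\<close>

lemma quot_mult_mat_vec:
  assumes n: "n > 0" and g: "g \<in> carrier_mat n n" and f: "f \<in> carrier_vec n"
  shows "quot n r (g *\<^sub>v f) = act_map n r g (quot n r f)"
proof
  fix k
  show "quot n r (g *\<^sub>v f) k = act_map n r g (quot n r f) k"
  proof (cases "k \<in> {1..r * n}")
    case False
    then show ?thesis by (auto simp: quot_def act_map_def act_entry_def intro!: sum.neutral)
  next
    case True
    define i c where "i = (k - 1) mod n" and "c = (k - 1) div n"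
    have i: "i < n" using n by (simp add: i_def)
    have c: "c < r" using True n by (auto simp: c_def less_mult_imp_div_less)
    have "act_map n r g (quot n r f) k =
      (\<Sum>k'\<in>{1..r * n}. if (k' - 1) div n \<le> c
        then fps_nth (g $$ (i, (k' - 1) mod n)) (c - (k' - 1) div n) *
          fps_nth (f $ ((k' - 1) mod n)) ((k' - 1) div n) else 0)"
      unfolding act_map_def using True
      by (intro sum.cong) (auto simp: act_entry_def quot_def i_def c_def)
    also have "\<dots> = (\<Sum>(j, d)\<in>{..<n} \<times> {..<r}. if d \<le> c
        then fps_nth (g $$ (i, j)) (c - d) * fps_nth (f $ j) d else 0)"
    proof (rule sum.reindex_bij_witness[of _ "\<lambda>(j, d). d * n + j + 1"
          "\<lambda>k'. ((k' - 1) mod n, (k' - 1) div n)"])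
      fix x assume "x \<in> {..<n} \<times> {..<r}"
      then obtain j d where x: "x = (j, d)" "j < n" "d < r" by auto
      have "d * n + j < d * n + n" using x by simp
      also have "d * n + n = (d + 1) * n" by simp
      also have "\<dots> \<le> r * n" using x by (intro mult_le_mono1) auto
      finally show "(case x of (j, d) \<Rightarrow> d * n + j + 1) \<in> {1..r * n}" using x by simp
    qed (use n in \<open>auto simp: less_mult_imp_div_less\<close>)
    also have "\<dots> = (\<Sum>j<n. \<Sum>d<r. if d \<le> c
        then fps_nth (g $$ (i, j)) (c - d) * fps_nth (f $ j) d else 0)"
      by (rule sum.cartesian_product[symmetric])
    also have "\<dots> = (\<Sum>j<n. fps_nth (g $$ (i, j) * f $ j) c)"
    proof (intro sum.cong refl)
      fix j
      have "(\<Sum>d<r. if d \<le> c then fps_nth (g $$ (i, j)) (c - d) * fps_nth (f $ j) d else 0) =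
          (\<Sum>d = 0..c. fps_nth (f $ j) d * fps_nth (g $$ (i, j)) (c - d))"
        using c by (intro sum.mono_neutral_cong_right) auto
      then show "(\<Sum>d<r. if d \<le> c then fps_nth (g $$ (i, j)) (c - d) * fps_nth (f $ j) d else 0) =
          fps_nth (g $$ (i, j) * f $ j) c"
        by (simp add: fps_mult_nth mult.commute[of "g $$ (i, j)"])
    qed
    also have "\<dots> = quot n r (g *\<^sub>v f) k"
      using True i g f unfolding i_def c_def
      by (simp add: quot_def scalar_prod_def fps_sum_nth lessThan_atLeast0)
    finally show ?thesis by simp
  qed
qed

lemma quot_surj:
  assumes "u \<in> Vs n r"
  obtains f where "f \<in> carrier_vec n" "quot n r f = u"
proof
  let ?f = "vec n (\<lambda>i. Abs_fps (\<lambda>c. u (c * n + i + 1)))"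
  show "?f \<in> carrier_vec n" by simp
  show "quot n r ?f = u"
  proof
    fix k
    show "quot n r ?f k = u k"
    proof (cases "k \<in> {1..r * n}")
      case True
      then have "n > 0" by (cases n) auto
      then show ?thesis using True by (simp add: quot_def)
    qed (use assms in \<open>auto simp: quot_def Vs_def\<close>)
  qed
qed

lemma act_eq_image:
  assumes "n > 0" "g \<in> carrier_mat n n" "W \<subseteq> Vs n r"
  shows "act n r g W = act_map n r g ` W"
proof (intro equalityI subsetI)
  fix w assume "w \<in> act n r g W"
  then show "w \<in> act_map n r g ` W"
    using assms by (auto simp: act_def quot_mult_mat_vec)
next
  fix w assume "w \<in> act_map n r g ` W"
  then obtain u where u: "u \<in> W" "w = act_map n r g u" by auto
  then obtain f where "f \<in> carrier_vec n" "quot n r f = u"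
    using assms(3) quot_surj by blast
  then show "w \<in> act n r g W"
    using assms u by (auto simp: act_def quot_mult_mat_vec[symmetric])
qed

section \<open>Bases of the points of a cell\<close>

lemma linear_act_map: "Vector_Spaces.linear fscale fscale (act_map n r g)"
  unfolding Vector_Spaces.linear_iff
  by (auto simp: fvec.vector_space_axioms act_map_def fscale_def fun_eq_iff algebra_simps
      sum.distrib sum_distrib_left)

lemma act_map_ebasis:
  assumes "k' \<in> {1..r * n}"
  shows "act_map n r g (ebasis k') = (\<lambda>k. act_entry n r g k k')"
  using assms by (auto simp: act_map_def ebasis_def fun_eq_iff if_distrib cong: if_cong)

lemma subspace_Vs: "fvec.subspace (Vs n r)"
  by (auto simp: fvec.subspace_def Vs_def fscale_def)

lemma basis_of_in_Gr:
  assumes "basis_of r b W" "\<And>l. l < r \<Longrightarrow> b l \<in> Vs n r"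
  shows "W \<in> Gr n r"
proof -
  have "b ` {..<r} \<subseteq> Vs n r" using assms(2) by auto
  then have "W \<subseteq> Vs n r"
    using assms(1) fvec.span_minimal[OF _ subspace_Vs, of "b ` {..<r}"]
    unfolding basis_of_def by blast
  moreover have "fvec.dim W = r"
    using assms(1) fvec.dim_span_eq_card_independent[of "b ` {..<r}"]
    by (auto simp: basis_of_def card_image)
  moreover have "fvec.subspace W"
    using assms(1) by (auto simp: basis_of_def)
  ultimately show ?thesis by (simp add: Gr_def)
qed

text \<open>The frame is in echelon form: column \<open>l\<close> has its first nonzero entry in row
  \<open>T ! l\<close>, and these pivots increase with \<open>l\<close>.\<close>

lemma basis_of_frame:
  fixes g :: "'a::field fps mat"
  assumes n: "n > 0" and g: "g \<in> iwahori n" and T: "T \<in> tuples n r"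
  shows "basis_of r (frame n r g T) (act n r g (Espan T))"
proof -
  let ?b = "frame n r g T"
  note tD = tuplesD[OF T]
  have diag: "?b l (T ! l) \<noteq> 0" if "l < r" for l
    using act_entry_diag[OF g] tD(2,3) that by (simp add: frame_def)
  have lower: "?b l' (T ! l) = 0" if "l < l'" "l' < r" for l l'
    using act_entry_lower[OF g] tD(4)[OF that] by (simp add: frame_def)
  have inj: "inj_on ?b {..<r}"
  proof (rule inj_onI)
    fix l l' assume "l \<in> {..<r}" "l' \<in> {..<r}" "?b l = ?b l'"
    then show "l = l'"
      using diag[of l] diag[of l'] lower[of l l'] lower[of l' l]
      by (cases l l' rule: linorder_cases) auto
  qed
  have "fvec.independent (?b ` {..<r})"
  proof (rule fvec.independent_if_scalars_zero)
    fix u x assume 0: "(\<Sum>v\<in>?b ` {..<r}. fscale (u v) v) = 0" and x: "x \<in> ?b ` {..<r}"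
    have zero: "(\<Sum>l<r. u (?b l) * ?b l k) = 0" for k
    proof -
      have "(\<Sum>v\<in>?b ` {..<r}. fscale (u v) v) k = (\<Sum>l<r. u (?b l) * ?b l k)"
        using inj by (simp add: sum.reindex fscale_def sum_fun_apply)
      then show ?thesis using 0 by simp
    qed
    \<comment> \<open>In the pivot row \<open>T ! l\<close> the earlier coefficients vanish by
      induction and the later columns have entry zero.\<close>
    have "u (?b l) = 0" if "l < r" for l
      using that
    proof (induction l rule: less_induct)
      case (less l)
      have "0 = (\<Sum>l'<r. u (?b l') * ?b l' (T ! l))" using zero by simp
      also have "\<dots> = (\<Sum>l'\<in>{l}. u (?b l') * ?b l' (T ! l))"
        using less by (intro sum.mono_neutral_right) (auto simp: lower less.IH neq_iff)
      finally show ?case using diag[OF less.prems] by simp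
    qed
    then show "u x = 0" using x by auto
  qed simp
  moreover have "fvec.span (?b ` {..<r}) = act n r g (Espan T)"
  proof -
    interpret L: Vector_Spaces.linear fscale fscale "act_map n r g"
      by (rule linear_act_map)
    have set: "set T = (!) T ` {..<r}" using tD(1) by (auto simp: set_conv_nth)
    have Vs: "Espan T \<subseteq> Vs n r" unfolding Espan_def
      using T by (intro fvec.span_minimal subspace_Vs) (auto simp: Vs_def ebasis_def tuples_def)
    have "?b ` {..<r} = act_map n r g ` ebasis ` set T"
      unfolding set image_image frame_def
      using tD(2,3) by (intro image_cong refl act_map_ebasis[symmetric]) auto
    then show ?thesis
      using act_eq_image[OF n _ Vs, of g] g by (simp add: iwahori_def L.span_image Espan_def)
  qed
  ultimately show ?thesis using inj by (simp add: basis_of_def)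
qed

text \<open>The factor is the determinant of the base change. It is the same for all
  \<open>I\<close>, so every linear form is scaled by it.\<close>

lemma plucker_change_basis:
  assumes "basis_of r b W" "basis_of r b' W"
  obtains d where "\<And>I. plucker r b' I = d * plucker r b I"
proof -
  have "\<forall>l\<in>{..<r}. \<exists>c. \<forall>k. b' l k = (\<Sum>l'<r. b l' k * c l')"
  proof
    fix l assume that: "l \<in> {..<r}"
    have "b' l \<in> fvec.span (b ` {..<r})"
      using assms that fvec.span_base[of "b' l" "b' ` {..<r}"] by (auto simp: basis_of_def)
    then obtain u where "b' l = (\<Sum>v\<in>b ` {..<r}. fscale (u v) v)"
      by (auto simp: fvec.span_finite)
    then have "b' l k = (\<Sum>l'<r. b l' k * u (b l'))" for k using assms(1)
      by (simp add: basis_of_def sum.reindex fscale_def sum_fun_apply mult.commute)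
    then show "\<exists>c. \<forall>k. b' l k = (\<Sum>l'<r. b l' k * c l')"
      by (intro exI[of _ "\<lambda>l'. u (b l')"] allI)
  qed
  then have "\<exists>c. \<forall>l\<in>{..<r}. \<forall>k. b' l k = (\<Sum>l'<r. b l' k * c l l')"
    by (rule bchoice)
  then obtain c where c: "\<forall>l\<in>{..<r}. \<forall>k. b' l k = (\<Sum>l'<r. b l' k * c l l')" ..
  then have "plucker r b' I = det (mat r r (\<lambda>(l', l). c l l')) * plucker r b I" for I
    unfolding plucker_minor
    using minor_mult_cols[of r b' "(!) I" b "\<lambda>l' l. c l l'"] c by (simp add: mult.commute)
  then show ?thesis using that by blast
qed

text \<open>As \<open>t\<close> commutes with \<open>g\<close>, it sends column \<open>l\<close> to
  the image of the basis vector with index \<open>T ! l + n\<close>. By stability this is a later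
  column or, beyond \<open>r n\<close>, zero; hence \<open>N\<close> is a 0/1 matrix.\<close>

lemma shift_triangular_frame:
  assumes n: "n > 0" and g: "g \<in> iwahori n" and T: "T \<in> tuples n r"
    and stable: "\<And>l. l < r \<Longrightarrow> T ! l + n \<le> r * n \<Longrightarrow> T ! l + n \<in> set T"
  shows "shift_triangular n r (frame n r g T)"
  unfolding shift_triangular_def
proof (intro conjI allI impI exI)
  fix l assume "l < r"
  show "frame n r g T l 0 = 0" by (simp add: frame_def act_entry_def)
next
  note tD = tuplesD[OF T]
  fix l k assume l: "l < r" and k: "k \<le> r * n"
  have shift: "frame n r g T l (k - n) = act_entry n r g k (T ! l + n)"
    unfolding frame_def by (rule act_entry_shift[OF n tD(2)[OF l] k])
  show "frame n r g T l (k - n) = (\<Sum>l' | l < l' \<and> l' < r.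
    (if T ! l' = T ! l + n then 1 else 0) * frame n r g T l' k)"
  proof (cases "T ! l + n \<le> r * n")
    case True
    then obtain m where m: "m < r" "T ! m = T ! l + n"
      using stable[OF l True] tD(1) by (auto simp: in_set_conv_nth)
    then have lm: "l < m" using tD(4)[of m l] l n by (cases l m rule: linorder_cases) auto
    have "T ! l' = T ! l + n \<longleftrightarrow> l' = m" if "l' < r" for l'
      using m tD(4)[of l' m] tD(4)[of m l'] that by (cases l' m rule: linorder_cases) auto
    then have "(\<Sum>l' | l < l' \<and> l' < r. (if T ! l' = T ! l + n then 1 else 0) * frame n r g T l' k) =
      (\<Sum>l' | l < l' \<and> l' < r. if l' = m then frame n r g T l' k else 0)"
      by (intro sum.cong) auto
    also have "\<dots> = frame n r g T m k" using lm m by simp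
    finally show ?thesis using m shift by (simp add: frame_def)
  next
    case False
    then have "T ! l' \<noteq> T ! l + n" if "l' < r" for l' using tD(3)[OF that] by auto
    then show ?thesis using shift False k act_entry_lower[OF g, of k "T ! l + n"] by simp
  qed
qed

subsection \<open>Linear independence of admissible coordinates\<close>

text \<open>Subtracting \<open>1\<close> gives exponent \<open>0\<close> at \<open>d = 0\<close>, so
  pivots become \<open>1\<close>. The base \<open>r + 1\<close> lets one exponent exceed
  \<open>r\<close> copies of any earlier one when \<open>r > 0\<close>.\<close>

definition curve_exp :: "nat \<Rightarrow> nat \<Rightarrow> nat" where
  "curve_exp r d = (r + 1) ^ d - 1"

lemma curve_exp_mono: "d \<le> d' \<Longrightarrow> curve_exp r d \<le> curve_exp r d'"
  by (simp add: curve_exp_def diff_le_mono power_increasing)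

lemma curve_exp_less:
  assumes "d < d'" "r > 0"
  shows "r * curve_exp r d < curve_exp r d'"
proof -
  obtain x where x: "(r + 1) ^ d = Suc x" by (cases "(r + 1) ^ d") auto
  have "(r + 1) * (r + 1) ^ d \<le> (r + 1) ^ d'"
    using assms(1) power_increasing[of "Suc d" d' "r + 1"] by simp
  then have "r * x + r + x + 1 \<le> (r + 1) ^ d'" unfolding x by simp
  then show ?thesis using assms(2) x unfolding curve_exp_def by simp
qed

text \<open>One exponent at \<open>z > d a\<close> outweighs all terms from position
  \<open>a\<close> on, of which there are at most \<open>r\<close>. Exponent sums are thereby
  compared lexicographically.\<close>

lemma sum_curve_exp_less:
  assumes a: "a < r" and d: "\<And>c. a \<le> c \<Longrightarrow> c < r \<Longrightarrow> d c \<le> d a" and z: "d a < z"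
  shows "(\<Sum>c<r. curve_exp r (d c)) < (\<Sum>c<a. curve_exp r (d c)) + curve_exp r z"
proof -
  have "{..<r} = {..<a} \<union> {a..<r}" using a by auto
  then have "(\<Sum>c<r. curve_exp r (d c)) =
      (\<Sum>c<a. curve_exp r (d c)) + (\<Sum>c = a..<r. curve_exp r (d c))"
    by (simp add: sum.union_disjoint ivl_disj_int)
  moreover have "(\<Sum>c = a..<r. curve_exp r (d c)) \<le> (r - a) * curve_exp r (d a)"
    using sum_bounded_above[of "{a..<r}" "\<lambda>c. curve_exp r (d c)" "curve_exp r (d a)"] d
    by (simp add: curve_exp_mono)
  moreover have "(r - a) * curve_exp r (d a) \<le> r * curve_exp r (d a)"
    by (intro mult_le_mono1) simp
  moreover have "r * curve_exp r (d a) < curve_exp r z"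
    using curve_exp_less[OF z] a by simp
  ultimately show ?thesis by linarith
qed

text \<open>The shape shared by all \<open>\<tau>\<^sub>l\<close>, with \<open>q = r + 1 - i\<close> for \<open>\<tau>\<^sub>l = \<phi>\<^sub>i\<^sub>j\<close>.\<close>

definition chain_shape :: "nat \<Rightarrow> nat \<Rightarrow> nat \<Rightarrow> nat list \<Rightarrow> bool" where
  "chain_shape n r q T \<longleftrightarrow> T \<in> tuples n r \<and> q \<le> r \<and>
     (\<forall>k. Suc k < q \<longrightarrow> T ! Suc k = T ! k + n) \<and>
     (\<forall>k. q \<le> k \<longrightarrow> k < r \<longrightarrow> T ! k = r * n + 1 + k - r) \<and>
     (q > 0 \<longrightarrow> r * n + 1 + q - r \<le> T ! (q - 1) + n)"

definition tuple_le :: "nat list \<Rightarrow> nat list \<Rightarrow> bool" where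
  "tuple_le T S \<longleftrightarrow> list_all2 (\<le>) T S"

lemma tuple_leD: "tuple_le T S \<Longrightarrow> T \<in> tuples n r \<Longrightarrow> k < r \<Longrightarrow> T ! k \<le> S ! k"
  using list_all2_nthD[of "(\<le>)" T S k] tuplesD(1)[of T n r] by (simp add: tuple_le_def)

text \<open>Pigeonhole: if \<open>S ! a < T ! a\<close>, every permutation pairs some row
  \<open>k \<le> a\<close> with a column \<open>\<sigma> k \<ge> a\<close>. That entry lies above
  the pivot, as \<open>S ! k \<le> S ! a < T ! a \<le> T ! \<sigma> k\<close>.\<close>

lemma minor_frame_eq_0:
  assumes g: "g \<in> iwahori n" and T: "T \<in> tuples n r" and S: "S \<in> tuples n r"
    and nle: "\<not> tuple_le T S"
  shows "minor r (frame n r g T) ((!) S) = 0"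
proof -
  obtain a where a: "a < r" "S ! a < T ! a"
    using nle tuplesD(1)[OF T] tuplesD(1)[OF S] by (auto simp: tuple_le_def list_all2_conv_all_nth not_le)
  have "(\<Prod>k = 0..<r. frame n r g T (\<sigma> k) (S ! k)) = 0" if \<sigma>: "\<sigma> permutes {0..<r}" for \<sigma>
  proof -
    have "\<not> \<sigma> ` {..a} \<subseteq> {..<a}"
    proof
      assume "\<sigma> ` {..a} \<subseteq> {..<a}"
      then have "card (\<sigma> ` {..a}) \<le> a" using card_mono[of "{..<a}"] by fastforce
      then show False using card_image[OF permutes_inj_on[OF \<sigma>, of "{..a}"]] by simp
    qed
    then obtain k where "k \<in> {..a}" "\<sigma> k \<notin> {..<a}" by blast
    then have k: "k \<le> a" "a \<le> \<sigma> k" by simp_all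
    have \<sigma>k: "\<sigma> k < r" using permutes_in_image[OF \<sigma>, of k] k a by simp
    have "S ! k \<le> S ! a" using tuplesD(4)[OF S, of k a] k(1) a(1) by (cases "k = a") auto
    moreover have "T ! a \<le> T ! \<sigma> k"
      using tuplesD(4)[OF T, of a "\<sigma> k"] k(2) \<sigma>k by (cases "a = \<sigma> k") auto
    ultimately have "frame n r g T (\<sigma> k) (S ! k) = 0"
      unfolding frame_def using a(2) by (intro act_entry_lower[OF g]) linarith
    then show ?thesis using k(1) a(1) by (intro prod_zero bexI[of _ k]) auto
  qed
  then show ?thesis unfolding minor_leibniz by (intro sum.neutral) auto
qed

text \<open>The frame of \<open>curve_mat\<close> with the parameter turned into an indeterminate.
  Columns congruent to \<open>T ! 0\<close> modulo \<open>n\<close> carry the curve; the others are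
  basis vectors.\<close>

definition curve_frame :: "nat \<Rightarrow> nat \<Rightarrow> nat list \<Rightarrow> nat \<Rightarrow> nat \<Rightarrow> 'a::comm_ring_1 poly" where
  "curve_frame n r T l k = (if k < T ! l then 0
     else if (T ! l - 1) mod n = (T ! 0 - 1) mod n then monom 1 (curve_exp r (k - T ! l))
     else if k = T ! l then 1 else 0)"

text \<open>The condition \<open>i0 \<le> c * n + i\<close> removes the constant terms above the
  diagonal in column \<open>i0\<close>, and the constant term on the diagonal is
  \<open>y ^ 0 = 1\<close>. So the matrix is in the Iwahori group for every \<open>y\<close>,
  including \<open>0\<close>.\<close>

definition curve_mat :: "nat \<Rightarrow> nat \<Rightarrow> nat \<Rightarrow> 'a::field \<Rightarrow> 'a fps mat" where
  "curve_mat n r i0 y = mat n n (\<lambda>(i, j). if j = i0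
     then Abs_fps (\<lambda>c. if i0 \<le> c * n + i then y ^ curve_exp r (c * n + i - i0) else 0)
     else if i = j then 1 else 0)"

lemma curve_mat_iwahori: "curve_mat n r i0 y \<in> iwahori n"
  by (rule iwahoriI) (auto simp: curve_mat_def curve_exp_def)

lemma frame_curve_mat:
  assumes n: "n > 0" and T: "T \<in> tuples n r" and l: "l < r" and k: "k \<in> {1..r * n}"
  shows "frame n r (curve_mat n r ((T ! 0 - 1) mod n) y) T l k = poly (curve_frame n r T l k) y"
proof (cases "k < T ! l")
  case True
  then show ?thesis
    using act_entry_lower[OF curve_mat_iwahori True] by (simp add: frame_def curve_frame_def)
next
  case False
  define p p' where "p = k - 1" and "p' = T ! l - 1"
  have kp: "k = p + 1" "T ! l = p' + 1"
    using k tuplesD(2)[OF T l] by (auto simp: p_def p'_def)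
  have le: "p' \<le> p" using False kp by simp
  have div: "p' div n \<le> p div n" using le by (rule div_le_mono)
  have "(p div n - p' div n) * n + p mod n = p - p' div n * n"
    using div div_mult_mod_eq[of p n] mult_le_mono1[OF div, of n]
    by (simp add: diff_mult_distrib)
  moreover have "p' = p' div n * n + p' mod n" by simp
  \<comment> \<open>Multiplying the special column by a power of \<open>t\<close> translates the
    curve: the exponent depends only on the distance \<open>p - p'\<close> from the pivot.\<close>
  ultimately have idx: "(p div n - p' div n) * n + p mod n - p' mod n = p - p'"
      "p' mod n \<le> (p div n - p' div n) * n + p mod n"
    using le by linarith+
  have entry: "frame n r (curve_mat n r i0 y) T l k =
      fps_nth (curve_mat n r i0 y $$ (p mod n, p' mod n)) (p div n - p' div n)" for i0
    using k kp div by (simp add: frame_def act_entry_def)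
  show ?thesis
  proof (cases "p' mod n = (T ! 0 - 1) mod n")
    case True
    then show ?thesis unfolding entry using n idx False
      by (simp add: curve_mat_def curve_frame_def kp poly_monom)
  next
    case ne: False
    have "p = p'" if "p mod n = p' mod n" "p div n - p' div n = 0"
      using that div by (metis diff_is_0_eq div_mult_mod_eq le_antisym)
    then show ?thesis unfolding entry using n ne False
      by (auto simp: curve_mat_def curve_frame_def kp)
  qed
qed

lemma prod_monom:
  assumes "finite A"
  shows "(\<Prod>k\<in>A. monom (1::'a::comm_semiring_1) (e k)) = monom 1 (sum e A)"
  using assms by (induction A rule: finite_induct) (auto simp: mult_monom monom_0 one_pCons)

lemma poly_minor: "poly (minor r b i) y = minor r (\<lambda>l k. poly (b l k) y) i"
  unfolding minor_leibniz poly_sum poly_mult poly_prod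
  by (intro sum.cong refl arg_cong2[of _ _ _ _ "(*)"]) (simp add: sign_def)

text \<open>For \<open>T\<close> of chain shape and \<open>S\<close> above it, this is the degree in
  \<open>y\<close> of the diagonal term of the minor with rows \<open>S\<close>.\<close>

definition lead_exp :: "nat \<Rightarrow> nat list \<Rightarrow> nat list \<Rightarrow> nat" where
  "lead_exp r T S = (\<Sum>c<r. curve_exp r (S ! c - T ! c))"

section \<open>Leading terms of minors along the curve\<close>

context
  fixes n r q :: nat and T :: "nat list"
  assumes n: "n > 0" and shape: "chain_shape n r q T"
begin

lemma T_tuple: "T \<in> tuples n r"
  using shape by (simp add: chain_shape_def)

text \<open>The tail of \<open>T\<close> is already as large as possible: strict increase and the
  bound \<open>r n\<close> force \<open>S ! k \<le> r n + 1 + k - r\<close>.\<close>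

lemma tail_eq:
  assumes S: "S \<in> tuples n r" "tuple_le T S" and k: "q \<le> k" "k < r"
  shows "S ! k = T ! k"
proof -
  have "S ! k' + (r - k') \<le> r * n + 1" if "k' < r" for k'
    using that
  proof (induction "r - k'" arbitrary: k')
    case (Suc d)
    show ?case
    proof (cases "Suc k' < r")
      case True
      then have "S ! Suc k' + (r - Suc k') \<le> r * n + 1" using Suc by auto
      moreover have "S ! k' < S ! Suc k'" using tuplesD(4)[OF S(1), of k' "Suc k'"] True by simp
      ultimately show ?thesis by linarith
    next
      case False
      then have "r - k' = 1" using Suc.prems by simp
      then show ?thesis using tuplesD(3)[OF S(1) Suc.prems] by simp
    qed
  qed simp
  then have "S ! k + (r - k) \<le> r * n + 1" using k(2) .
  moreover have "T ! k = r * n + 1 + k - r" using shape k by (simp add: chain_shape_def)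
  moreover have "T ! k \<le> S ! k" by (rule tuple_leD[OF S(2) T_tuple k(2)])
  ultimately show ?thesis using k(2) by linarith
qed

text \<open>On the head \<open>T\<close> rises by exactly \<open>n\<close> and an admissible
  \<open>S\<close> by at most \<open>n\<close>, so the excess cannot grow. On the tail it is
  \<open>0\<close>.\<close>

lemma excess_decreasing:
  assumes S: "S \<in> tuples n r" "tuple_le T S" "admissible n r S"
    and a: "a < q" "a \<le> c" "c < r"
  shows "S ! c - T ! c \<le> S ! a - T ! a"
proof (cases "c < q")
  case False
  then show ?thesis using tail_eq[OF S(1,2)] a by simp
next
  case True
  with \<open>a \<le> c\<close> show ?thesis
  proof (induction c rule: dec_induct)
    case (step c)
    have "q \<le> r" using shape by (simp add: chain_shape_def)
    then have "S ! Suc c \<le> S ! c + n"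
      using S(3)[unfolded admissible_def, rule_format, of c] step.prems by (simp add: seq_ext_def)
    moreover have "T ! Suc c = T ! c + n"
      using shape step.prems by (simp add: chain_shape_def)
    ultimately show ?case using step by linarith
  qed simp
qed

text \<open>This puts all head columns on the curve, as translates of one special column by powers
  of \<open>t\<close>.\<close>

lemma head_mod:
  assumes "k < q"
  shows "(T ! k - 1) mod n = (T ! 0 - 1) mod n"
  using assms
proof (induction k)
  case (Suc k)
  have "k < r" using shape Suc.prems by (simp add: chain_shape_def)
  then have "T ! Suc k - 1 = (T ! k - 1) + n"
    using shape Suc.prems tuplesD(2)[OF T_tuple, of k] by (simp add: chain_shape_def)
  then show ?case using Suc by simp
qed simp

lemma curve_frame_diag:
  assumes S: "S \<in> tuples n r" "tuple_le T S" and k: "k < r"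
  shows "curve_frame n r T k (S ! k) = monom 1 (curve_exp r (S ! k - T ! k))"
proof (cases "k < q")
  case True
  then show ?thesis
    using tuple_leD[OF S(2) T_tuple k] head_mod[OF True] by (simp add: curve_frame_def)
next
  case False
  then have "S ! k = T ! k" using tail_eq[OF S] k by simp
  then show ?thesis by (simp add: curve_frame_def curve_exp_def monom_0 one_pCons)
qed

text \<open>Let \<open>a\<close> be the first index moved by \<open>\<sigma>\<close>. If
  \<open>a\<close> is in the tail, the factor in row \<open>a\<close> is zero. Otherwise column
  \<open>a\<close> is paired with a row \<open>b > a\<close>, and the exponent at
  \<open>S ! b - T ! a > S ! a - T ! a\<close> alone exceeds all diagonal exponents from
  \<open>a\<close> on.\<close>

lemma coeff_prod_curve_frame:
  assumes S: "S \<in> tuples n r" "tuple_le T S" "admissible n r S"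
    and \<sigma>: "\<sigma> permutes {0..<r}" "\<sigma> \<noteq> id" and j: "j \<le> lead_exp r T S"
  shows "coeff (\<Prod>k = 0..<r. curve_frame n r T (\<sigma> k) (S ! k)) j = (0::'a::comm_ring_1)"
proof -
  let ?f = "\<lambda>k. curve_frame n r T (\<sigma> k) (S ! k) :: 'a poly"
  define a where "a = (LEAST k. \<sigma> k \<noteq> k)"
  have ex: "\<exists>k. \<sigma> k \<noteq> k" using \<sigma>(2) by (auto simp: fun_eq_iff)
  have a: "\<sigma> a \<noteq> a" unfolding a_def by (rule LeastI_ex[OF ex])
  have fixed: "\<sigma> k = k" if "k < a" for k using that not_less_Least unfolding a_def by blast
  have ar: "a < r" using a permutes_not_in[OF \<sigma>(1), of a] by (cases "a < r") auto
  have inj: "inj \<sigma>" using \<sigma>(1) by (rule permutes_inj)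
  have gt: "a < \<sigma> a" using fixed[of "\<sigma> a"] a inj by (metis injD linorder_neqE_nat)
  show ?thesis
  proof (cases "q \<le> a")
    case True
    have "\<sigma> a < r" using permutes_in_image[OF \<sigma>(1), of a] ar by simp
    then have "S ! a < T ! \<sigma> a"
      using tail_eq[OF S(1,2) True ar] tuplesD(4)[OF T_tuple gt] by simp
    then have "?f a = 0" by (simp add: curve_frame_def)
    then have "prod ?f {0..<r} = 0" using ar by (intro prod_zero bexI[of _ a]) auto
    then show ?thesis by simp
  next
    case False
    then have aq: "a < q" by simp
    obtain b where b: "\<sigma> b = a" using permutes_surj[OF \<sigma>(1)] by (metis surjD)
    have br: "b < r" using permutes_in_image[OF \<sigma>(1), of b] b ar by simp
    have ab: "a < b" using fixed[of b] b a by (metis linorder_neqE_nat)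
    have T_le: "T ! a \<le> S ! a" by (rule tuple_leD[OF S(2) T_tuple ar])
    have S_lt: "S ! a < S ! b" using tuplesD(4)[OF S(1) ab br] .
    have fb: "?f b = monom 1 (curve_exp r (S ! b - T ! a))"
      using T_le S_lt head_mod[OF aq] by (simp add: curve_frame_def b)
    \<comment> \<open>\<open>E\<close> collects the factors in the rows before \<open>a\<close>,
      which are diagonal, and the factor in row \<open>b\<close>; the product is divisible by
      \<open>y ^ E\<close>.\<close>
    define E where "E = (\<Sum>c<a. curve_exp r (S ! c - T ! c)) + curve_exp r (S ! b - T ! a)"
    have "prod ?f ({..<a} \<union> {b}) = prod ?f {..<a} * ?f b"
      using ab by (subst prod.union_disjoint) auto
    also have "prod ?f {..<a} = (\<Prod>c<a. monom 1 (curve_exp r (S ! c - T ! c)))"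
      using ar by (intro prod.cong refl) (simp add: fixed curve_frame_diag[OF S(1,2)])
    finally have "prod ?f ({..<a} \<union> {b}) = monom 1 E"
      by (simp only: prod_monom finite_lessThan fb mult_monom E_def mult_1)
    moreover have "prod ?f {0..<r} = prod ?f ({0..<r} - ({..<a} \<union> {b})) * prod ?f ({..<a} \<union> {b})"
      using ar br by (intro prod.subset_diff) auto
    ultimately have "prod ?f {0..<r} = monom 1 E * prod ?f ({0..<r} - ({..<a} \<union> {b}))"
      by (simp add: mult.commute)
    moreover have "lead_exp r T S < E"
      unfolding lead_exp_def E_def
      using excess_decreasing[OF S aq] T_le S_lt
      by (intro sum_curve_exp_less[OF ar]) auto
    ultimately show ?thesis using j by (simp add: coeff_monom_mult)
  qed
qed

text \<open>Up to this degree only the identity permutation contributes, and its term is a monic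
  monomial.\<close>

lemma coeff_minor_curve_frame:
  assumes S: "S \<in> tuples n r" "tuple_le T S" "admissible n r S" and j: "j \<le> lead_exp r T S"
  shows "coeff (minor r (curve_frame n r T) ((!) S)) j =
    (if j = lead_exp r T S then 1 else (0::'a::comm_ring_1))"
proof -
  let ?P = "\<lambda>\<sigma>. \<Prod>k = 0..<r. curve_frame n r T (\<sigma> k) (S ! k) :: 'a poly"
  have sgn: "signof \<sigma> * p = smult (signof \<sigma>) p" for \<sigma> and p :: "'a poly"
    by (simp add: sign_def)
  have vanish: "coeff (?P \<sigma>) j = 0" if "\<sigma> permutes {0..<r}" "\<sigma> \<noteq> id" for \<sigma>
    by (rule coeff_prod_curve_frame[OF S that j])
  have "coeff (minor r (curve_frame n r T) ((!) S)) j =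
      (\<Sum>\<sigma> | \<sigma> permutes {0..<r}. signof \<sigma> * coeff (?P \<sigma>) j)"
    unfolding minor_leibniz sgn coeff_sum coeff_smult ..
  also have "\<dots> = (\<Sum>\<sigma>\<in>{id}. signof \<sigma> * coeff (?P \<sigma>) j)"
    using vanish by (intro sum.mono_neutral_right) (auto simp: finite_permutations permutes_id)
  also have "\<dots> = coeff (?P id) j" by (simp add: sign_id)
  also have "?P id = monom 1 (lead_exp r T S)"
    by (simp add: curve_frame_diag[OF S(1,2)] prod_monom lead_exp_def lessThan_atLeast0)
  finally show ?thesis by simp
qed

text \<open>The first difference lies in the head. The tuple with the smaller entry there has no
  larger excess afterwards, so the single larger exponent of the other tuple outweighs its remaining
  terms.\<close>

lemma lead_exp_inj:
  assumes S: "S \<in> tuples n r" "tuple_le T S" "admissible n r S"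
    and S': "S' \<in> tuples n r" "tuple_le T S'" "admissible n r S'"
    and eq: "lead_exp r T S = lead_exp r T S'"
  shows "S = S'"
proof (rule ccontr)
  assume "S \<noteq> S'"
  then have ex: "\<exists>k. k < r \<and> S ! k \<noteq> S' ! k"
    using tuplesD(1)[OF S(1)] tuplesD(1)[OF S'(1)] by (auto simp: list_eq_iff_nth_eq)
  define a where "a = (LEAST k. k < r \<and> S ! k \<noteq> S' ! k)"
  have a: "a < r" "S ! a \<noteq> S' ! a" using LeastI_ex[OF ex] unfolding a_def by auto
  have same: "S ! k = S' ! k" if "k < a" for k
    using not_less_Least[of k "\<lambda>k. k < r \<and> S ! k \<noteq> S' ! k"] that a(1) unfolding a_def by auto
  have aq: "a < q" using tail_eq[OF S(1,2), of a] tail_eq[OF S'(1,2), of a] a by force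
  have less: "lead_exp r T U < lead_exp r T U'"
    if U: "U \<in> tuples n r" "tuple_le T U" "admissible n r U" and U': "tuple_le T U'"
      and lt: "U ! a < U' ! a" and same: "\<And>k. k < a \<Longrightarrow> U ! k = U' ! k" for U U'
  proof -
    have "lead_exp r T U < (\<Sum>c<a. curve_exp r (U ! c - T ! c)) + curve_exp r (U' ! a - T ! a)"
      unfolding lead_exp_def
      using excess_decreasing[OF U aq] lt tuple_leD[OF U(2) T_tuple a(1)]
      by (intro sum_curve_exp_less[OF a(1)]) auto
    also have "\<dots> = (\<Sum>c\<in>{..<a} \<union> {a}. curve_exp r (U' ! c - T ! c))"
      by (simp add: same)
    also have "\<dots> \<le> lead_exp r T U'"
      unfolding lead_exp_def using a(1) by (intro sum_mono2) auto
    finally show ?thesis .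
  qed
  show False
    using less[OF S S'(2)] less[OF S' S(2)] same a(2) eq by (metis linorder_neqE_nat less_irrefl)
qed

text \<open>Along the curve the relation becomes a polynomial with infinitely many zeros. Its minors
  have distinct lowest degrees, so the coefficients vanish one after another by increasing
  \<open>lead_exp\<close>.\<close>

lemma admissible_independent:
  fixes c :: "nat list \<Rightarrow> 'a::field"
  assumes inf: "infinite (UNIV :: 'a set)"
    and zero: "\<And>g. g \<in> iwahori n \<Longrightarrow>
      (\<Sum>S | S \<in> tuples n r \<and> admissible n r S \<and> tuple_le T S.
        c S * minor r (frame n r g T) ((!) S)) = 0"
    and S: "S \<in> tuples n r" "admissible n r S" "tuple_le T S"
  shows "c S = 0"
proof -
  let ?A = "{S. S \<in> tuples n r \<and> admissible n r S \<and> tuple_le T S}"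
  have fin: "finite ?A" using finite_tuples[of n r] by simp
  define P where "P = (\<Sum>S\<in>?A. smult (c S) (minor r (curve_frame n r T) ((!) S)))"
  have "poly P y = 0" for y
  proof -
    let ?g = "curve_mat n r ((T ! 0 - 1) mod n) y"
    have "poly P y = (\<Sum>S\<in>?A. c S * minor r (frame n r ?g T) ((!) S))"
      unfolding P_def poly_sum poly_smult poly_minor
    proof (intro sum.cong refl arg_cong2[of _ _ _ _ "(*)"] minor_cong)
      fix S k l assume "S \<in> ?A" "k < r" "l < r"
      then show "poly (curve_frame n r T l (S ! k)) y = frame n r ?g T l (S ! k)"
        using tuplesD(2,3)[of S n r k] by (intro frame_curve_mat[OF n T_tuple, symmetric]) auto
    qed
    then show ?thesis using zero[OF curve_mat_iwahori] by simp
  qed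
  then have "{y. poly P y = 0} = UNIV" by simp
  then have P0: "P = 0" using inf poly_roots_finite[of P] by metis
  show ?thesis
    using S
  proof (induction "lead_exp r T S" arbitrary: S rule: less_induct)
    case less
    let ?e = "lead_exp r T S"
    have "0 = coeff P ?e" by (simp add: P0)
    also have "\<dots> = (\<Sum>S'\<in>?A. c S' * coeff (minor r (curve_frame n r T) ((!) S')) ?e)"
      by (simp add: P_def coeff_sum)
    also have "\<dots> = (\<Sum>S'\<in>{S}. c S' * coeff (minor r (curve_frame n r T) ((!) S')) ?e)"
    proof (intro sum.mono_neutral_right ballI)
      fix S' assume S': "S' \<in> ?A - {S}"
      consider "lead_exp r T S' < ?e" | "?e < lead_exp r T S'"
        using lead_exp_inj[of S S'] less.prems S' by (cases "lead_exp r T S'" ?e rule: linorder_cases) auto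
      then show "c S' * coeff (minor r (curve_frame n r T) ((!) S')) ?e = 0"
      proof cases
        case 1
        then have "c S' = 0" using less.hyps S' by blast
        then show ?thesis by simp
      next
        case 2
        then show ?thesis using S' by (simp add: coeff_minor_curve_frame)
      qed
    qed (use fin less.prems in auto)
    also have "\<dots> = c S" using less.prems by (simp add: coeff_minor_curve_frame)
    finally show ?case by simp
  qed
qed

end

subsection \<open>The chain of Schubert varieties\<close>

text \<open>The value \<open>i = r + 1\<close> is included because division with remainder yields it
  at the last index of the chain when \<open>n > 1\<close>; then only the tail remains.\<close>

lemma chain_shape_phi:
  assumes n: "n > 0" and i: "1 \<le> i" "i \<le> r + 1" and j: "1 \<le> j" "j \<le> n"
  shows "chain_shape n r (r + 1 - i) (phi n r i j)"
proof -
  let ?T = "phi n r i j"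
  define q where "q = r + 1 - i"
  \<comment> \<open>A nonempty head is the progression \<open>m, m + n, ...\<close>.\<close>
  define m where "m = (i - 1) * n + 1 + j - i"
  have q: "q \<le> r" using i by (simp add: q_def)
  have ile: "i - 1 \<le> (i - 1) * n" using n by simp
  have m: "1 \<le> m" using ile i j unfolding m_def by linarith
  have rn: "r \<le> r * n" using n by simp
  have len: "length ?T = r" by (simp add: phi_def)
  have head: "?T ! k = k * n + m" if "k < q" for k
  proof -
    have "?T ! k = (i - 1 + k) * n + 1 + j - i" using that q by (simp add: phi_def q_def)
    also have "(i - 1 + k) * n = k * n + (i - 1) * n" by (simp add: add_mult_distrib)
    finally show ?thesis using ile i j unfolding m_def by linarith
  qed
  have tail: "?T ! k = r * n + 1 + k - r" if "q \<le> k" "k < r" for k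
    using that by (simp add: phi_def q_def)
  \<comment> \<open>This is the last head entry plus \<open>n\<close>. Here \<open>j \<ge> 1\<close>
    gives the final clause of \<open>chain_shape\<close>, and \<open>j \<le> n\<close> keeps the
    head below the tail.\<close>
  have last: "(q - 1) * n + m + n = r * n + j + q - r" if "0 < q"
  proof -
    have "(q - 1 + (i - 1) + 1) * n = r * n" using that i by (simp add: q_def)
    then have "(q - 1) * n + (i - 1) * n + n = r * n" by (simp add: add_mult_distrib)
    moreover have "q + i = r + 1" using that by (simp add: q_def)
    ultimately show ?thesis using ile i j rn q unfolding m_def by linarith
  qed
  have mono: "?T ! k < ?T ! k'" if kk: "k < k'" "k' < r" for k k'
  proof -
    consider "k' < q" | "k < q" "q \<le> k'" | "q \<le> k" using kk by linarith
    then show ?thesis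
    proof cases
      case 1
      then show ?thesis using kk n by (simp add: head)
    next
      case 2
      have "k * n \<le> (q - 1) * n" using 2 by (intro mult_le_mono1) simp
      then have "k * n + m + n \<le> r * n + j + q - r" using last 2 by linarith
      then show ?thesis using 2 kk head[of k] tail[of k'] j rn by linarith
    next
      case 3
      then show ?thesis using kk rn tail[of k] tail[of k'] by linarith
    qed
  qed
  have range: "?T ! k \<in> {1..r * n}" if k: "k < r" for k
  proof -
    have "?T ! k = k * n + m \<or> ?T ! k = r * n + 1 + k - r"
      using head tail k by (cases "k < q") simp_all
    then have "1 \<le> ?T ! k" using m rn by linarith
    moreover have "?T ! k \<le> ?T ! (r - 1)"
    proof (cases "k < r - 1")
      case True
      then show ?thesis using mono[of k "r - 1"] k by simp
    next
      case False
      then have "k = r - 1" using k by linarith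
      then show ?thesis by simp
    qed
    moreover have "?T ! (r - 1) \<le> r * n"
    proof (cases "q = r")
      case True
      then have "?T ! (r - 1) = (q - 1) * n + m" "(q - 1) * n + m + n = r * n + j + q - r"
        using head[of "q - 1"] last k by simp_all
      then show ?thesis using True j by linarith
    next
      case False
      then show ?thesis using tail[of "r - 1"] q k rn by linarith
    qed
    ultimately show ?thesis by simp
  qed
  have "?T \<in> tuples n r"
    using len mono range
    by (auto simp: tuples_def sorted_wrt_iff_nth_less set_conv_nth)
  moreover have "?T ! Suc k = ?T ! k + n" if "Suc k < q" for k
    using that by (simp add: head)
  moreover have "r * n + 1 + q - r \<le> ?T ! (q - 1) + n" if "q > 0"
    using head[of "q - 1"] last that j rn by linarith
  ultimately show ?thesis using q tail unfolding chain_shape_def q_def[symmetric] by blast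
qed

lemma chain_shape_tau:
  assumes "n > 0" "1 \<le> l" "l \<le> r * (n - 1) + 1"
  obtains q where "chain_shape n r q (tau n r l)"
proof -
  have "(l - 1) div (n - 1) \<le> r"
  proof (cases "n = 1")
    case False
    have "(l - 1) div (n - 1) \<le> (r * (n - 1)) div (n - 1)"
      using assms by (intro div_le_mono) simp
    also have "\<dots> = r" using assms(1) False by simp
    finally show ?thesis .
  qed simp
  moreover have "(l - 1) mod (n - 1) + 1 \<le> n"
  proof (cases "n = 1")
    case True
    then show ?thesis using assms(2,3) by simp
  next
    case False
    then have "(l - 1) mod (n - 1) < n - 1" using assms(1) by (intro mod_less_divisor) linarith
    then show ?thesis by linarith
  qed
  ultimately have "chain_shape n r (r + 1 - ((l - 1) div (n - 1) + 1)) (tau n r l)"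
    unfolding tau_def by (intro chain_shape_phi[OF assms(1)]) simp_all
  then show ?thesis by (rule that)
qed

lemma chain_shape_ws:
  assumes "n > 0"
  obtains q where "chain_shape n r q (ws n r)"
  using chain_shape_tau[OF assms, of 1 r] tau_1[of n r] by auto

text \<open>Going back from the entry \<open>r n + 1\<close> at position \<open>r\<close>, each step
  loses at most \<open>n\<close>. Thus independence on \<open>X(w_s)\<close> concerns all admissible
  coordinates.\<close>

lemma tuple_le_ws:
  assumes S: "S \<in> tuples n r" "admissible n r S"
  shows "tuple_le (ws n r) S"
proof -
  have bound: "k * n + 1 \<le> seq_ext n r S k" if "k \<le> r" for k
    using that
  proof (induction k rule: inc_induct)
    case (step k)
    then show ?case using S(2)[unfolded admissible_def, rule_format, of k] by simp
  qed (simp add: seq_ext_def)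
  have "k * n + 1 \<le> S ! k" if "k < r" for k
    using bound[of k] that by (simp add: seq_ext_def)
  then show ?thesis
    using tuplesD(1)[OF S(1)] by (simp add: tuple_le_def list_all2_conv_all_nth ws_def)
qed

text \<open>A head entry moves to the next one, and the last head entry moves into the tail by the
  final clause of \<open>chain_shape\<close>. The tail fills an interval ending at
  \<open>r n\<close>.\<close>

lemma chain_shape_stable:
  assumes n: "n > 0" and shape: "chain_shape n r q T" and l: "l < r" "T ! l + n \<le> r * n"
  shows "T ! l + n \<in> set T"
proof -
  have T: "T \<in> tuples n r" and q: "q \<le> r" and rn: "r \<le> r * n"
    using shape n by (simp_all add: chain_shape_def)
  have tail: "x \<in> set T" if "r * n + 1 + q - r \<le> x" "x \<le> r * n" for x
  proof -
    define k where "k = x + r - r * n - 1"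
    have "q \<le> k" "k < r" "r * n + 1 + k - r = x"
      using that rn l unfolding k_def by linarith+
    then have "T ! k = x" "k < length T"
      using shape tuplesD(1)[OF T] by (simp_all add: chain_shape_def)
    then show ?thesis by (metis nth_mem)
  qed
  consider "Suc l < q" | "q = Suc l" | "q \<le> l" by linarith
  then show ?thesis
  proof cases
    case 1
    then have "T ! Suc l = T ! l + n" "Suc l < length T"
      using shape q tuplesD(1)[OF T] by (simp_all add: chain_shape_def)
    then show ?thesis by (metis nth_mem)
  next
    case 2
    then show ?thesis using shape l by (intro tail) (simp_all add: chain_shape_def)
  next
    case 3
    then have "T ! l = r * n + 1 + l - r" using shape l by (simp add: chain_shape_def)
    then show ?thesis using 3 l rn by (intro tail) linarith+
  qed
qed

lemma shift_triangular_chain: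
  assumes "n > 0" "chain_shape n r q T" "g \<in> iwahori n"
  shows "shift_triangular n r (frame n r g T)"
  using assms chain_shape_stable[OF assms(1,2)]
  by (intro shift_triangular_frame) (simp_all add: chain_shape_def)

section \<open>Linear forms on Schubert cells and their closures\<close>

lemma schubert_cell_subset_Gr:
  assumes "n > 0" "T \<in> tuples n r"
  shows "schubert_cell n r T \<subseteq> Gr n r"
proof
  fix W assume "W \<in> schubert_cell n r T"
  then obtain g where g: "g \<in> iwahori n" "W = act n r g (Espan T)"
    by (auto simp: schubert_cell_def)
  show "W \<in> Gr n r"
    unfolding g(2) using basis_of_frame[OF assms(1) g(1) assms(2)]
    by (rule basis_of_in_Gr) (auto simp: frame_def act_entry_def Vs_def)
qed

text \<open>A form \<open>P\<close> vanishing on the cell is itself one of the equations of the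
  closure, and the cell lies in its closure. Since a change of basis scales linear forms, one frame
  per point suffices.\<close>

lemma vanishes_on_schubert_var_iff:
  fixes P :: "'a::alg_closed_field ppoly"
  assumes n: "n > 0" and T: "T \<in> tuples n r" and P: "P \<in> hom_polys n r 1"
  shows "vanishes_on r (schubert_var n r T) P \<longleftrightarrow>
    (\<forall>g\<in>iwahori n. peval (plucker r (frame n r g T)) P = 0)"
proof
  assume van: "vanishes_on r (schubert_var n r T) P"
  show "\<forall>g\<in>iwahori n. peval (plucker r (frame n r g T)) P = 0"
  proof
    fix g :: "'a fps mat" assume g: "g \<in> iwahori n"
    let ?W = "act n r g (Espan T)"
    have "?W \<in> schubert_cell n r T" using g by (simp add: schubert_cell_def)
    then have "?W \<in> schubert_var n r T"
      using schubert_cell_subset_Gr[OF n T]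
      unfolding schubert_var_def zariski_closure_def ideal_part_def vanishes_on_def by blast
    then show "peval (plucker r (frame n r g T)) P = 0"
      using van basis_of_frame[OF n g T] unfolding vanishes_on_def by blast
  qed
next
  assume 0: "\<forall>g\<in>iwahori n. peval (plucker r (frame n r g T)) P = 0"
  have "vanishes_on r (schubert_cell n r T) P"
    unfolding vanishes_on_def
  proof (intro ballI allI impI)
    fix W and b :: "nat \<Rightarrow> nat \<Rightarrow> 'a"
    assume "W \<in> schubert_cell n r T" and b: "basis_of r b W"
    then obtain g where g: "g \<in> iwahori n" "W = act n r g (Espan T)"
      by (auto simp: schubert_cell_def)
    obtain d where "\<And>I. plucker r b I = d * plucker r (frame n r g T) I"
      using plucker_change_basis[OF basis_of_frame[OF n g(1) T] b[unfolded g(2)]] by blast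
    then have "peval (plucker r b) P = d * peval (plucker r (frame n r g T)) P"
      by (simp add: peval_hom_polys_1[OF P] sum_distrib_left mult.left_commute)
    then show "peval (plucker r b) P = 0" using 0 g(1) by simp
  qed
  then show "vanishes_on r (schubert_var n r T) P"
    using P unfolding schubert_var_def zariski_closure_def ideal_part_def vanishes_on_def by blast
qed

text \<open>Over a finite field, \<open>1\<close> plus the product of all \<open>X - a\<close> would
  have positive degree and no root.\<close>

lemma infinite_UNIV_alg_closed: "infinite (UNIV :: 'a::alg_closed_field set)"
proof
  assume fin: "finite (UNIV :: 'a set)"
  define p where "p = (\<Prod>a\<in>(UNIV :: 'a set). [:- a, 1:]) + 1"
  have "degree (\<Prod>a\<in>(UNIV :: 'a set). [:- a, 1:]) = card (UNIV :: 'a set)"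
    by (subst degree_prod_eq_sum_degree) auto
  moreover have "card (UNIV :: 'a set) > 0" using fin by (simp add: card_gt_0_iff)
  ultimately have "degree p > 0" unfolding p_def by (subst degree_add_eq_left) auto
  then obtain x where "poly p x = 0" using alg_closed_imp_poly_has_root by blast
  moreover have "poly (\<Prod>a\<in>(UNIV :: 'a set). [:- a, 1:]) x = 0"
    using fin by (simp add: poly_prod)
  ultimately show False by (simp add: p_def)
qed

lemma hom_polys_1_straightens:
  fixes P :: "'a::field ppoly"
  assumes n: "n > 0" and P: "P \<in> hom_polys n r 1"
  shows "straightens n r (\<lambda>b. peval (plucker r b) P)"
proof -
  have "straightens n r (\<lambda>b :: nat \<Rightarrow> nat \<Rightarrow> 'a. \<Sum>I\<in>tuples n r. linear_coeff P I * minor r b ((!) I))"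
    using tuplesD(3) by (intro straightens_sum straightens_scale minor_straightens n) blast
  then show ?thesis
    by (rule straightens_cong) (simp add: peval_hom_polys_1[OF P] plucker_minor)
qed

text \<open>
  On frames of the whole chain a linear form is given by its straightened form, whose coefficients
  are determined by the restriction to \<open>X(w\<^sub>s)\<close>.
\<close>

lemma vanishes_on_ws_imp:
  fixes P :: "'a::alg_closed_field ppoly"
  assumes n: "n > 0" and P: "P \<in> hom_polys n r 1" and T: "chain_shape n r q T"
    and van: "vanishes_on r (schubert_var n r (ws n r)) P"
  shows "vanishes_on r (schubert_var n r T) P"
proof -
  obtain q' where ws: "chain_shape n r q' (ws n r)" using chain_shape_ws[OF n] .
  have tup: "T \<in> tuples n r" "ws n r \<in> tuples n r" using T ws by (simp_all add: chain_shape_def)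
  obtain d where d: "\<forall>b. shift_triangular n r b \<longrightarrow> peval (plucker r b) P =
      (\<Sum>S | S \<in> tuples n r \<and> admissible n r S. d S * minor r b ((!) S))"
    using hom_polys_1_straightens[OF n P] unfolding straightens_def ..
  have adm: "{S. S \<in> tuples n r \<and> admissible n r S \<and> tuple_le (ws n r) S} =
      {S. S \<in> tuples n r \<and> admissible n r S}"
    using tuple_le_ws by blast
  \<comment> \<open>Every admissible \<open>S\<close> is above \<open>w_s\<close>, so independence
    reaches all coefficients of the straightened form.\<close>
  have "d S = 0" if S: "S \<in> tuples n r" "admissible n r S" for S
  proof (rule admissible_independent[OF n ws infinite_UNIV_alg_closed _ S tuple_le_ws[OF S]])
    fix g :: "'a fps mat" assume g: "g \<in> iwahori n"
    have "peval (plucker r (frame n r g (ws n r))) P = 0"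
      using van g by (simp add: vanishes_on_schubert_var_iff[OF n tup(2) P])
    then show "(\<Sum>S | S \<in> tuples n r \<and> admissible n r S \<and> tuple_le (ws n r) S.
        d S * minor r (frame n r g (ws n r)) ((!) S)) = 0"
      unfolding adm using d shift_triangular_chain[OF n ws g] by simp
  qed
  then have "peval (plucker r (frame n r g T)) P = 0" if "g \<in> iwahori n" for g
    using d shift_triangular_chain[OF n T that] by simp
  then show ?thesis by (simp add: vanishes_on_schubert_var_iff[OF n tup(1) P])
qed

lemma straightening_relation_exists:
  fixes n r :: nat
  assumes n: "n > 0" and I: "I \<in> tuples n r"
  obtains a :: "nat list \<Rightarrow> 'a::alg_closed_field"
  where "vanishes_on r (schubert_var n r (ws n r)) (straightening_form n r I a)"
proof -
  obtain q where ws: "chain_shape n r q (ws n r)" using chain_shape_ws[OF n] .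
  have tup: "ws n r \<in> tuples n r" using ws by (simp add: chain_shape_def)
  have "straightens n r (\<lambda>b :: nat \<Rightarrow> nat \<Rightarrow> 'a. minor r b ((!) I))"
    using n tuplesD(3)[OF I] by (rule minor_straightens)
  then obtain a where a: "\<forall>b :: nat \<Rightarrow> nat \<Rightarrow> 'a. shift_triangular n r b \<longrightarrow> minor r b ((!) I) =
      (\<Sum>S | S \<in> tuples n r \<and> admissible n r S. a S * minor r b ((!) S))"
    unfolding straightens_def ..
  show ?thesis
  proof (rule that)
    show "vanishes_on r (schubert_var n r (ws n r)) (straightening_form n r I a)"
      unfolding vanishes_on_schubert_var_iff[OF n tup straightening_form_in_hom_polys[OF I]]
    proof
      fix g :: "'a fps mat" assume "g \<in> iwahori n"
      then have "shift_triangular n r (frame n r g (ws n r))"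
        by (rule shift_triangular_chain[OF n ws])
      then show "peval (plucker r (frame n r g (ws n r))) (straightening_form n r I a) = 0"
        using a by (simp add: straightening_form_def peval_simps plucker_minor)
    qed
  qed
qed

text \<open>The second conjunct allows any family of relations valid on \<open>X(w_s)\<close>.
  Straightening forms contain distinct non-admissible coordinates, so their span misses the
  admissible \<open>p_S\<close> that vanish on \<open>X(tau_l)\<close>; these enter through
  \<open>vanishing_coords\<close>.\<close>

theorem corollary4p6p4:
  fixes n s r l :: nat
  assumes "n > 0" and "s > 0" and "r = s * n"
    and "1 \<le> l" and "l \<le> r * (n - 1) + 1"
  shows "(\<forall>I\<in>straightening_indices TYPE('a::alg_closed_field) n r.
            \<exists>a :: nat list \<Rightarrow> 'a.
              vanishes_on r (schubert_var n r (ws n r)) (straightening_form n r I a)) \<and>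
         (\<forall>a :: nat list \<Rightarrow> nat list \<Rightarrow> 'a.
            (\<forall>I\<in>straightening_indices TYPE('a) n r.
               vanishes_on r (schubert_var n r (ws n r)) (straightening_form n r I (a I))) \<longrightarrow>
            ppoly.span
              ((\<lambda>I. straightening_form n r I (a I)) ` straightening_indices TYPE('a) n r
                \<union> vanishing_coords n r (schubert_var n r (tau n r l)))
            = ideal_part n r 1 (schubert_var n r (tau n r l)))"
proof (intro conjI ballI allI impI)
  fix I assume "I \<in> straightening_indices TYPE('a) n r"
  then have "I \<in> tuples n r" by (simp add: straightening_indices_def)
  then show "\<exists>a :: nat list \<Rightarrow> 'a.
      vanishes_on r (schubert_var n r (ws n r)) (straightening_form n r I a)"
    using straightening_relation_exists[OF assms(1)] by blast
next
  fix a :: "nat list \<Rightarrow> nat list \<Rightarrow> 'a"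
  assume a: "\<forall>I\<in>straightening_indices TYPE('a) n r.
    vanishes_on r (schubert_var n r (ws n r)) (straightening_form n r I (a I))"
  let ?T = "tau n r l"
  let ?X = "schubert_var n r ?T :: (nat \<Rightarrow> 'a) set set"
  let ?G = "(\<lambda>I. straightening_form n r I (a I)) ` straightening_indices TYPE('a) n r
    \<union> vanishing_coords n r ?X"
  let ?A = "{S. S \<in> tuples n r \<and> admissible n r S \<and> tuple_le ?T S}"
  have n: "n > 0" by fact
  obtain q where shape: "chain_shape n r q ?T" using chain_shape_tau assms by blast
  have T: "?T \<in> tuples n r" using shape by (simp add: chain_shape_def)
  have "?G \<subseteq> ideal_part n r 1 ?X"
  proof
    fix P assume "P \<in> ?G"
    then consider I where "I \<in> straightening_indices TYPE('a) n r"
        "P = straightening_form n r I (a I)"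
      | J where "J \<in> tuples n r" "vanishes_on r ?X (pvar J :: 'a ppoly)" "P = pvar J"
      by (auto simp: vanishing_coords_def)
    then show "P \<in> ideal_part n r 1 ?X"
    proof cases
      case 1
      then have P: "P \<in> hom_polys n r 1"
        unfolding 1(2) by (intro straightening_form_in_hom_polys) (simp add: straightening_indices_def)
      moreover have "vanishes_on r ?X P"
        using 1 a by (intro vanishes_on_ws_imp[OF n P shape]) simp
      ultimately show ?thesis by (simp add: ideal_part_def)
    next
      case 2
      then show ?thesis using pvar_in_hom_polys[OF 2(1)] by (simp add: ideal_part_def)
    qed
  qed
  then have sub: "ppoly.span ?G \<subseteq> ideal_part n r 1 ?X"
    by (rule ppoly.span_minimal) (rule subspace_ideal_part)
  \<comment> \<open>\<open>standard e\<close> is the normal form with coefficients \<open>e\<close>.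
    It will be shown that every linear form has one modulo the span of the generators.\<close>
  define standard where "standard = (\<lambda>e. \<Sum>S\<in>?A. pconst (e S :: 'a) * pvar S)"
  define reducible where "reducible = (\<lambda>P. \<exists>e. P - standard e \<in> ppoly.span ?G)"
  have fin: "finite ?A" using finite_tuples[of n r] by simp
  have redI: "reducible P" if "P - standard e \<in> ppoly.span ?G" for P e
    unfolding reducible_def using that by (intro exI[of _ e])
  have red_span: "reducible P" if "P \<in> ppoly.span ?G" for P
  proof -
    have "standard (\<lambda>_. 0) = 0" by (simp add: standard_def pconst_def)
    then have "P - standard (\<lambda>_. 0) \<in> ppoly.span ?G" using that by simp
    then show ?thesis by (rule redI)
  qed
  have red_add: "reducible (P + Q)" if P: "reducible P" and Q: "reducible Q" for P Q
  proof -
    obtain e e' where "P - standard e \<in> ppoly.span ?G" "Q - standard e' \<in> ppoly.span ?G"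
      using P Q unfolding reducible_def by blast
    then have "(P - standard e) + (Q - standard e') \<in> ppoly.span ?G" by (rule ppoly.span_add)
    also have "(P - standard e) + (Q - standard e') = P + Q - standard (\<lambda>S. e S + e' S)"
      by (simp add: standard_def pconst_def single_add distrib_right sum.distrib)
    finally show ?thesis by (rule redI)
  qed
  have red_scale: "reducible (pconst c * P)" if P: "reducible P" for c P
  proof -
    obtain e where "P - standard e \<in> ppoly.span ?G" using P unfolding reducible_def by blast
    then have "pconst c * (P - standard e) \<in> ppoly.span ?G" by (rule ppoly.span_scale)
    also have "pconst c * (P - standard e) = pconst c * P - standard (\<lambda>S. c * e S)"
      by (simp add: standard_def pconst_def mult_single sum_distrib_left right_diff_distrib
          flip: mult.assoc)
    finally show ?thesis by (rule redI)
  qed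
  have red_sum: "reducible (\<Sum>x\<in>B. f x)" if "\<And>x. x \<in> B \<Longrightarrow> reducible (f x)"
    for B :: "nat list set" and f
    using that
    by (induction B rule: infinite_finite_induct) (auto intro: red_add red_span ppoly.span_zero)
  have red_van: "reducible (pvar I)" if "I \<in> tuples n r" "vanishes_on r ?X (pvar I :: 'a ppoly)" for I
    using that by (intro red_span ppoly.span_base) (auto simp: vanishing_coords_def)
  have red_adm: "reducible (pvar I)" if I: "I \<in> tuples n r" "admissible n r I" for I
  proof (cases "tuple_le ?T I")
    case True
    have "standard (\<lambda>S. if S = I then 1 else 0) = (\<Sum>S\<in>?A. if S = I then pvar S else 0)"
      unfolding standard_def by (intro sum.cong) (auto simp: pconst_def)
    also have "\<dots> = pvar I" using fin I True by simp
    finally have "pvar I - standard (\<lambda>S. if S = I then 1 else 0) \<in> ppoly.span ?G"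
      using ppoly.span_zero by simp
    then show ?thesis by (rule redI)
  next
    case False
    have "vanishes_on r ?X (pvar I :: 'a ppoly)"
      unfolding vanishes_on_schubert_var_iff[OF n T pvar_in_hom_polys[OF I(1)]]
    proof
      fix g :: "'a fps mat" assume "g \<in> iwahori n"
      then have "minor r (frame n r g ?T) ((!) I) = 0" by (rule minor_frame_eq_0[OF _ T I(1) False])
      then show "peval (plucker r (frame n r g ?T)) (pvar I) = 0"
        by (simp add: peval_simps plucker_minor)
    qed
    then show ?thesis using red_van I(1) by blast
  qed
  have red_pvar: "reducible (pvar I)" if I: "I \<in> tuples n r" for I
  proof (cases "admissible n r I")
    case True
    then show ?thesis using I red_adm by blast
  next
    case nonadm: False
    show ?thesis
    \<comment> \<open>A non-admissible coordinate vanishing on \<open>X(w_s)\<close> has no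
      straightening relation in the family, but it also vanishes on \<open>X(tau_l)\<close> and is
      thus a generator itself.\<close>
    proof (cases "vanishes_on r (schubert_var n r (ws n r)) (pvar I :: 'a ppoly)")
      case True
      then show ?thesis
        using I vanishes_on_ws_imp[OF n pvar_in_hom_polys[OF I] shape] red_van by blast
    next
      case False
      then have "I \<in> straightening_indices TYPE('a) n r"
        using I nonadm by (simp add: straightening_indices_def)
      then have "reducible (straightening_form n r I (a I))"
        by (intro red_span ppoly.span_base) blast
      moreover have "reducible (\<Sum>S | S \<in> tuples n r \<and> admissible n r S. pconst (a I S) * pvar S)"
        using red_adm by (intro red_sum red_scale) blast
      ultimately show ?thesis
        using red_add by (fastforce simp: straightening_form_def)
    qed
  qed
  have "ideal_part n r 1 ?X \<subseteq> ppoly.span ?G"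
  proof
    fix P assume P: "P \<in> ideal_part n r 1 ?X"
    then have "P = (\<Sum>I\<in>tuples n r. pconst (linear_coeff P I) * pvar I)"
      unfolding ideal_part_def by (blast intro: hom_polys_1_expand)
    moreover have "reducible (\<Sum>I\<in>tuples n r. pconst (linear_coeff P I) * pvar I)"
      by (intro red_sum red_scale red_pvar)
    ultimately have "reducible P" by (rule ssubst)
    then obtain e where e: "P - standard e \<in> ppoly.span ?G"
      unfolding reducible_def ..
    \<comment> \<open>The normal form of an element of the ideal lies in the ideal, so independence
      makes it zero.\<close>
    have "P - (P - standard e) \<in> ideal_part n r 1 ?X"
      by (rule ppoly.subspace_diff[OF subspace_ideal_part P subsetD[OF sub e]])
    also have "P - (P - standard e) = standard e" by simp
    finally have std: "standard e \<in> hom_polys n r 1" "vanishes_on r ?X (standard e)"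
      by (simp_all add: ideal_part_def)
    have "e S = 0" if "S \<in> ?A" for S
    proof (rule admissible_independent[OF n shape infinite_UNIV_alg_closed])
      fix g :: "'a fps mat" assume "g \<in> iwahori n"
      then have "peval (plucker r (frame n r g ?T)) (standard e) = 0"
        using std(2) unfolding vanishes_on_schubert_var_iff[OF n T std(1)] by blast
      then show "(\<Sum>S\<in>?A. e S * minor r (frame n r g ?T) ((!) S)) = 0"
        by (simp add: standard_def peval_simps plucker_minor)
    qed (use that in auto)
    then have "standard e = 0"
      unfolding standard_def by (intro sum.neutral ballI) (simp add: pconst_def)
    then show "P \<in> ppoly.span ?G" using e by simp
  qed
  with sub show "ppoly.span ?G = ideal_part n r 1 ?X" by blast
qed

end
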